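(* Let $(E,d)$ be a metric space and $m\ge 1$. Every current $T\in\mathbf{M}_{m,b}(E)$ contains a cycle $C$ (that is, there is a cycle $C$ of $T$) such that $T-C$ is acyclic. In particular, any $T\in\mathbf{M}_{m,b}(E)$ can be decomposed as $T=A+C$, where $C$ is a cycle of $T$ and $A$ is acyclic.
   Context: $\mathrm{Lip}(E)$ denotes the real-valued Lipschitz functions on $E$, $\mathrm{Lip}_{bs}(E)$ those with bounded support, $\mathrm{Lip}(\pi)$ the Lipschitz constant. $\mathbf{M}_0(E)$ is the set of finite signed Borel measures on $E$ concentrated on a $\sigma$-compact set; $\mathbf{M}_{0,b}(E)$ is the set of real set functions $\mu$ on bounded Borel sets such that $B\mapsto\mu(U\cap B)$ belongs to $\mathbf{M}_0(E)$ for every bounded Borel $U$ (nonnegative ones are extended canonically to measures on all Borel sets). For $m\ge1$, $\mathbf{M}_{m,b}(E)$ ($m$-dimensional metric currents with locally finite mass) is the set of functionals $T(f\,d\pi_1\wedge\dots\wedge d\pi_m)$ on $\mathrm{Lip}_{bs}(E)\times[\mathrm{Lip}(E)]^m$ such that: (1) $T$ is multilinear; (2) if $\pi_i^j\to\pi_i$ pointwise as $j\to\infty$ for all $i$ and $\sup_{i,j}\mathrm{Lip}(\pi_i^j)<\infty$ then $T(f\,d\pi_1^j\wedge\dots\wedge d\pi_m^j)\to T(f\,d\pi_1\wedge\dots\wedge d\pi_m)$ for all $f$; (3) $T(f\,d\pi_1\wedge\dots\wedge d\pi_m)=0$ if some $\pi_i$ vanishes on $\mathrm{supp} f$; (4)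 there is a nonnegative $\mu\in\mathbf{M}_{0,b}(E)$ with $|T(f\,d\pi_1\wedge\dots\wedge d\pi_m)|\le\prod_i\mathrm{Lip}(\pi_i)\int_E|f|\,d\mu$. The least such $\mu$ is the mass $\|T\|$. The boundary is $\partial T(f\,d\pi_1\wedge\dots\wedge d\pi_{m-1}):=T(\sigma\,df\wedge d\pi_1\wedge\dots\wedge d\pi_{m-1})$, where $\sigma\in\mathrm{Lip}_{bs}(E)$ is any function equal to $1$ on $\mathrm{supp} f$. For $S,T\in\mathbf{M}_{m,b}(E)$, $S$ is a subcurrent of $T$, written $S\le T$, if $\|T\|=\|S\|+\|T-S\|$ as measures. $C\in\mathbf{M}_{m,b}(E)$ is a cycle of $T$ if $C\le T$ and $\partial C=0$. $T$ is acyclic if $C=0$ is the only cycle of $T$. *)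

theory Defs
  imports "HOL-Analysis.Analysis" "HOL-Library.Function_Algebras"
begin

section \<open>Lipschitz functions\<close>

definition Lip :: "('a::metric_space \<Rightarrow> real) set" where
  "Lip = {f. \<exists>L. L-lipschitz_on UNIV f}"

definition lip_const :: "('a::metric_space \<Rightarrow> real) \<Rightarrow> real" where
  "lip_const f = Inf {L. L-lipschitz_on UNIV f}"

definition supp :: "('a::metric_space \<Rightarrow> real) \<Rightarrow> 'a set" where
  "supp f = closure {x. f x \<noteq> 0}"

definition Lip_bs :: "('a::metric_space \<Rightarrow> real) set" where
  "Lip_bs = {f \<in> Lip. bounded (supp f)}"

section \<open>Measures\<close>

definition sigma_compact :: "'a::topological_space set \<Rightarrow> bool" where
  "sigma_compact K \<longleftrightarrow> (\<exists>F :: nat \<Rightarrow> 'a set. (\<forall>n. compact (F n)) \<and> K = (\<Union>n. F n))"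

text \<open>Finite signed Borel measures are real-valued countably additive set functions; only their
  values on Borel sets matter.\<close>

definition signed_borel_measure :: "('a::topological_space set \<Rightarrow> real) \<Rightarrow> bool" where
  "signed_borel_measure \<mu> \<longleftrightarrow>
     \<mu> {} = 0 \<and>
     (\<forall>A :: nat \<Rightarrow> 'a set. range A \<subseteq> sets borel \<longrightarrow> disjoint_family A \<longrightarrow>
        (\<lambda>n. \<mu> (A n)) sums \<mu> (\<Union>n. A n))"

definition concentrated_on :: "('a::topological_space set \<Rightarrow> real) \<Rightarrow> 'a set \<Rightarrow> bool" where
  "concentrated_on \<mu> K \<longleftrightarrow> (\<forall>B \<in> sets borel. B \<inter> K = {} \<longrightarrow> \<mu> B = 0)"

definition M0 :: "('a::metric_space set \<Rightarrow> real) set" where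
  "M0 = {\<mu>. signed_borel_measure \<mu> \<and> (\<exists>K. sigma_compact K \<and> concentrated_on \<mu> K)}"

definition bounded_borel :: "'a::metric_space set set" where
  "bounded_borel = {U \<in> sets borel. bounded U}"

text \<open>A set function on the bounded Borel sets is encoded as a total function that takes the
  value \<open>0\<close> on all other sets.\<close>

definition M0b :: "('a::metric_space set \<Rightarrow> real) set" where
  "M0b = {\<mu>. (\<forall>U \<in> bounded_borel. (\<lambda>B. \<mu> (U \<inter> B)) \<in> M0) \<and> (\<forall>B. B \<notin> bounded_borel \<longrightarrow> \<mu> B = 0)}"

definition M0b_nonneg :: "('a::metric_space set \<Rightarrow> real) set" where
  "M0b_nonneg = {\<mu> \<in> M0b. \<forall>B \<in> bounded_borel. 0 \<le> \<mu> B}"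

text \<open>The canonical extension of a nonnegative \<open>\<mu> \<in> M0b\<close> to a measure on all Borel sets.\<close>

definition borel_extension :: "('a::metric_space set \<Rightarrow> real) \<Rightarrow> 'a measure" where
  "borel_extension \<mu> =
     measure_of UNIV (sets borel) (\<lambda>B. SUP U \<in> bounded_borel. ennreal (\<mu> (U \<inter> B)))"

section \<open>Metric currents with locally finite mass\<close>

text \<open>\<open>T f [\<pi>\<^sub>1, \<dots>, \<pi>\<^sub>m]\<close> stands for \<open>T (f d\<pi>\<^sub>1 \<and> \<dots> \<and> d\<pi>\<^sub>m)\<close>. Functionals are
  total functions that take the value \<open>0\<close> outside \<open>Lip_bs \<times> Lip\<^sup>m\<close>, so that equality, sums and
  differences of currents are equality, pointwise sums and pointwise differences of functions.\<close>

type_synonym 'a functional = "('a \<Rightarrow> real) \<Rightarrow> ('a \<Rightarrow> real) list \<Rightarrow> real"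

definition Lip_tuples :: "nat \<Rightarrow> ('a::metric_space \<Rightarrow> real) list set" where
  "Lip_tuples m = {\<pi>. length \<pi> = m \<and> set \<pi> \<subseteq> Lip}"

definition multilinear_functional :: "nat \<Rightarrow> 'a::metric_space functional \<Rightarrow> bool" where
  "multilinear_functional m T \<longleftrightarrow>
     (\<forall>f \<in> Lip_bs. \<forall>g \<in> Lip_bs. \<forall>\<pi> \<in> Lip_tuples m. \<forall>a b.
        T (\<lambda>x. a * f x + b * g x) \<pi> = a * T f \<pi> + b * T g \<pi>) \<and>
     (\<forall>f \<in> Lip_bs. \<forall>\<pi> \<in> Lip_tuples m. \<forall>i<m. \<forall>u \<in> Lip. \<forall>v \<in> Lip. \<forall>a b.
        T f (\<pi>[i := (\<lambda>x. a * u x + b * v x)]) = a * T f (\<pi>[i := u]) + b * T f (\<pi>[i := v]))"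

definition continuous_functional :: "nat \<Rightarrow> 'a::metric_space functional \<Rightarrow> bool" where
  "continuous_functional m T \<longleftrightarrow>
     (\<forall>f \<in> Lip_bs. \<forall>\<pi> \<in> Lip_tuples m. \<forall>\<pi>s :: nat \<Rightarrow> ('a \<Rightarrow> real) list.
        (\<forall>j. \<pi>s j \<in> Lip_tuples m) \<longrightarrow>
        (\<forall>i<m. \<forall>x. (\<lambda>j. (\<pi>s j ! i) x) \<longlonglongrightarrow> (\<pi> ! i) x) \<longrightarrow>
        (\<exists>L. \<forall>j. \<forall>i<m. lip_const (\<pi>s j ! i) \<le> L) \<longrightarrow>
        (\<lambda>j. T f (\<pi>s j)) \<longlonglongrightarrow> T f \<pi>)"

definition local_functional :: "nat \<Rightarrow> 'a::metric_space functional \<Rightarrow> bool" where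
  "local_functional m T \<longleftrightarrow>
     (\<forall>f \<in> Lip_bs. \<forall>\<pi> \<in> Lip_tuples m.
        (\<exists>i<m. \<forall>x \<in> supp f. (\<pi> ! i) x = 0) \<longrightarrow> T f \<pi> = 0)"

definition mass_bounds :: "nat \<Rightarrow> 'a::metric_space functional \<Rightarrow> ('a set \<Rightarrow> real) set" where
  "mass_bounds m T =
     {\<mu> \<in> M0b_nonneg. \<forall>f \<in> Lip_bs. \<forall>\<pi> \<in> Lip_tuples m.
        \<bar>T f \<pi>\<bar> \<le> (\<Prod>i<m. lip_const (\<pi> ! i)) * (\<integral>x. \<bar>f x\<bar> \<partial>borel_extension \<mu>)}"

definition currents :: "nat \<Rightarrow> 'a::metric_space functional set" where
  "currents m =
     {T. multilinear_functional m T \<and> continuous_functional m T \<and> local_functional m T \<and>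
         mass_bounds m T \<noteq> {} \<and>
         (\<forall>f \<pi>. \<not> (f \<in> Lip_bs \<and> \<pi> \<in> Lip_tuples m) \<longrightarrow> T f \<pi> = 0)}"

definition mass :: "nat \<Rightarrow> 'a::metric_space functional \<Rightarrow> 'a measure" where
  "mass m T = borel_extension
     (THE \<mu>. \<mu> \<in> mass_bounds m T \<and> (\<forall>\<nu> \<in> mass_bounds m T. \<forall>B \<in> bounded_borel. \<mu> B \<le> \<nu> B))"

text \<open>For a current \<open>T\<close> the value does not depend on the choice of the cut-off \<open>\<sigma>\<close>; see
  \<open>boundary_eq\<close> below.\<close>

definition boundary :: "'a::metric_space functional \<Rightarrow> 'a functional" where
  "boundary T = (\<lambda>f \<pi>.
     if f \<in> Lip_bs then T (SOME \<sigma>. \<sigma> \<in> Lip_bs \<and> (\<forall>x \<in> supp f. \<sigma> x = 1)) (f # \<pi>) else 0)"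

section \<open>Subcurrents, cycles and acyclic currents\<close>

definition subcurrent :: "nat \<Rightarrow> 'a::metric_space functional \<Rightarrow> 'a functional \<Rightarrow> bool" where
  "subcurrent m S T \<longleftrightarrow>
     S \<in> currents m \<and> T \<in> currents m \<and>
     (\<forall>B \<in> sets borel.
        emeasure (mass m T) B = emeasure (mass m S) B + emeasure (mass m (T - S)) B)"

definition cycle_of :: "nat \<Rightarrow> 'a::metric_space functional \<Rightarrow> 'a functional \<Rightarrow> bool" where
  "cycle_of m C T \<longleftrightarrow> subcurrent m C T \<and> boundary C = 0"

definition acyclic_current :: "nat \<Rightarrow> 'a::metric_space functional \<Rightarrow> bool" where
  "acyclic_current m T \<longleftrightarrow> T \<in> currents m \<and> (\<forall>C. cycle_of m C T \<longleftrightarrow> C = 0)"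

section \<open>The boundary is well defined\<close>

lemma LipI: "L-lipschitz_on UNIV f \<Longrightarrow> f \<in> Lip"
  by (auto simp: Lip_def)

lemma cutoff_exists:
  fixes f :: "'a::metric_space \<Rightarrow> real"
  assumes "f \<in> Lip_bs"
  shows "\<exists>\<sigma>. \<sigma> \<in> Lip_bs \<and> (\<forall>x \<in> supp f. \<sigma> x = 1)"
proof (cases "supp f = {}")
  case True
  have "0-lipschitz_on UNIV (\<lambda>x::'a. 0::real)"
    by (auto simp: lipschitz_on_def)
  then have "(\<lambda>x::'a. 0::real) \<in> Lip_bs"
    by (auto simp: Lip_bs_def supp_def intro: LipI)
  with True show ?thesis by blast
next
  case False
  define S where "S = supp f"
  define \<sigma> where "\<sigma> = (\<lambda>x. max 0 (1 - infdist x S))"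
  have "1-lipschitz_on UNIV \<sigma>"
  proof (rule lipschitz_onI)
    fix x y :: 'a
    have "\<bar>infdist x S - infdist y S\<bar> \<le> dist x y"
      using infdist_triangle[of x S y] infdist_triangle[of y S x] by (auto simp: dist_commute)
    then show "dist (\<sigma> x) (\<sigma> y) \<le> 1 * dist x y"
      by (auto simp: \<sigma>_def dist_real_def max_def)
  qed simp
  moreover have "bounded (supp \<sigma>)"
  proof -
    obtain c r where r: "\<And>y. y \<in> S \<Longrightarrow> dist c y \<le> r"
      using assms unfolding S_def Lip_bs_def bounded_def by auto
    have "dist c x \<le> r + 1" if "\<sigma> x \<noteq> 0" for x
    proof -
      have "infdist x S < 1" using that by (auto simp: \<sigma>_def max_def split: if_splits)
      then obtain y where "y \<in> S" "dist x y < 1"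
        using False infdist_attains_inf infdist_notempty[of S x] cInf_lessD[of "dist x ` S" 1]
        by (auto simp: S_def)
      then show ?thesis using r[of y] dist_triangle2[of c x y] by linarith
    qed
    then have "bounded {x. \<sigma> x \<noteq> 0}" unfolding bounded_def by blast
    then show ?thesis by (simp add: supp_def bounded_closure)
  qed
  moreover have "\<forall>x \<in> supp f. \<sigma> x = 1"
    by (auto simp: \<sigma>_def S_def)
  ultimately show ?thesis by (auto simp: Lip_bs_def intro: LipI)
qed

lemma Lip_bs_diff:
  assumes "f \<in> Lip_bs" "g \<in> Lip_bs"
  shows "(\<lambda>x. f x - g x) \<in> Lip_bs"
proof -
  have "supp (\<lambda>x. f x - g x) \<subseteq> supp f \<union> supp g"
    unfolding supp_def closure_Un[symmetric] by (rule closure_mono) auto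
  then show ?thesis
    using assms by (auto simp: Lip_bs_def Lip_def intro: lipschitz_on_diff bounded_subset[OF bounded_Un[THEN iffD2]])
qed

lemma boundary_eq:
  assumes T: "T \<in> currents (Suc n)" and f: "f \<in> Lip_bs" and \<pi>: "\<pi> \<in> Lip_tuples n"
    and \<sigma>: "\<sigma> \<in> Lip_bs" "\<And>x. x \<in> supp f \<Longrightarrow> \<sigma> x = 1"
  shows "boundary T f \<pi> = T \<sigma> (f # \<pi>)"
proof -
  define \<tau> where "\<tau> = (SOME \<sigma>. \<sigma> \<in> Lip_bs \<and> (\<forall>x \<in> supp f. \<sigma> x = 1))"
  have \<tau>: "\<tau> \<in> Lip_bs" "\<And>x. x \<in> supp f \<Longrightarrow> \<tau> x = 1"
    using someI_ex[OF cutoff_exists[OF f]] unfolding \<tau>_def by blast+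
  have fp: "f # \<pi> \<in> Lip_tuples (Suc n)"
    using f \<pi> by (auto simp: Lip_tuples_def Lip_bs_def)
  have "supp (\<lambda>x. \<tau> x - \<sigma> x) \<subseteq> {x. f x = 0}"
  proof -
    have "continuous_on UNIV f"
      using f by (auto simp: Lip_bs_def Lip_def intro: lipschitz_on_continuous_on)
    then have "closed {x. f x = 0}"
      by (intro closed_Collect_eq) auto
    moreover have "{x. \<tau> x - \<sigma> x \<noteq> 0} \<subseteq> {x. f x = 0}"
      using \<tau>(2) \<sigma>(2) closure_subset[of "{x. f x \<noteq> 0}"] unfolding supp_def by force
    ultimately show ?thesis unfolding supp_def by (intro closure_minimal)
  qed
  then have "\<exists>i<Suc n. \<forall>x \<in> supp (\<lambda>x. \<tau> x - \<sigma> x). ((f # \<pi>) ! i) x = 0"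
    by (intro exI[of _ 0]) auto
  then have "T (\<lambda>x. \<tau> x - \<sigma> x) (f # \<pi>) = 0"
    using T Lip_bs_diff[OF \<tau>(1) \<sigma>(1)] fp unfolding currents_def local_functional_def by blast
  moreover have "T (\<lambda>x. 1 * \<tau> x + (-1) * \<sigma> x) (f # \<pi>) = 1 * T \<tau> (f # \<pi>) + (-1) * T \<sigma> (f # \<pi>)"
    using T \<tau>(1) \<sigma>(1) fp unfolding currents_def multilinear_functional_def by blast
  ultimately show ?thesis using f by (simp add: boundary_def \<tau>_def)
qed

end

theory Submission
  imports Defs
begin

text \<open>
  The mass. If two measures bound \<open>T\<close>, then so does the measure that agrees with the first one on a
  Borel set \<open>P\<close> and with the second one off \<open>P\<close>. Hence the infimum of all bounds, taken separately on
  each bounded Borel set, is additive; it is the least bound \<open>\<parallel>T\<parallel>\<close>.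

  The decomposition. Starting with \<open>S\<^sub>0 = 0\<close>, choose a cycle \<open>C\<^sub>k\<close> of \<open>T - S\<^sub>k\<close> whose mass on a ball
  \<open>U\<^sub>k\<close> is at least half of what cycles of \<open>T - S\<^sub>k\<close> can attain there, and let \<open>S\<^sub>k\<^sub>+\<^sub>1 = S\<^sub>k + C\<^sub>k\<close>. The
  balls are enumerated in such a way that every radius recurs infinitely often. Since
  \<open>\<parallel>T\<parallel> = \<parallel>C\<^sub>0\<parallel> + \<dots> + \<parallel>C\<^sub>n\<^sub>-\<^sub>1\<parallel> + \<parallel>T - S\<^sub>n\<parallel>\<close>, the series of the \<open>C\<^sub>k\<close> converges to a cycle \<open>C\<close> of \<open>T\<close>.
  A cycle of \<open>T - C\<close> is a cycle of every \<open>T - S\<^sub>k\<close>, so its mass on a fixed ball is at most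
  \<open>2 \<parallel>C\<^sub>k\<parallel>\<close> of that ball for infinitely many \<open>k\<close>, and these numbers tend to \<open>0\<close>.
\<close>

section \<open>Lipschitz functions and locally finite set functions\<close>

text \<open>A current of locally finite mass may have infinite total mass, so there is no single
  finite quantity to exhaust. Only masses of bounded sets are finite; hence the greedy choice looks
  at one ball at a time. A cycle of largest mass on a ball need not exist, and half of the supremum
  is enough: the chosen masses on a fixed ball are summable, so any fixed factor would do. A cycle
  \<open>C'\<close> of \<open>T - C\<close> is one of \<open>T - S n\<close> because
  \<open>T - S n = C' + (T - C - C') + (C - S n)\<close> and the masses of the three parts add up
  exactly. For the mass, the obstacle is that an infimum of measures taken set by set is in general
  only superadditive, and that it need not be clear that it still bounds \<open>T\<close>. Patching
  makes a single bound nearly optimal on finitely many disjoint sets at once. Two sets give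
  subadditivity; the level sets of a test function give the bound. Since currents accept only
  Lipschitz arguments, patching along a Borel set relies on the density of Lipschitz functions in
  \<open>L^1\<close> of a finite Borel measure.\<close>

lemma lip_const_nonneg:
  assumes "f \<in> Lip"
  shows "0 \<le> lip_const f"
  using assms unfolding lip_const_def Lip_def
  by (intro cInf_greatest) (auto dest: lipschitz_on_nonneg)

lemma prod_lip_const_nonneg:
  assumes "\<pi> \<in> Lip_tuples m"
  shows "0 \<le> (\<Prod>i<m. lip_const (\<pi> ! i))"
  using assms by (intro prod_nonneg) (auto simp: Lip_tuples_def intro!: lip_const_nonneg)

lemma Lip_borel_measurable:
  assumes "f \<in> Lip"
  shows "f \<in> borel_measurable borel"
proof -
  obtain L where "L-lipschitz_on UNIV f"
    using assms by (auto simp: Lip_def)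
  then show ?thesis
    by (intro borel_measurable_continuous_onI lipschitz_on_continuous_on)
qed

lemma Lip_bs_borel_measurable: "f \<in> Lip_bs \<Longrightarrow> f \<in> borel_measurable borel"
  by (simp add: Lip_bs_def Lip_borel_measurable)

lemma supp_bounded_borel: "f \<in> Lip_bs \<Longrightarrow> supp f \<in> bounded_borel"
  by (auto simp: Lip_bs_def bounded_borel_def supp_def)

lemma supp_zero: "x \<notin> supp f \<Longrightarrow> f x = 0"
  using closure_subset[of "{x. f x \<noteq> 0}"] by (auto simp: supp_def)

lemma Lip_bs_bounded:
  assumes "f \<in> Lip_bs"
  obtains M where "0 \<le> M" "\<And>x. \<bar>f x\<bar> \<le> M"
proof -
  obtain L where L: "L-lipschitz_on UNIV f"
    using assms by (auto simp: Lip_bs_def Lip_def)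
  have "bounded (supp f)"
    using assms by (simp add: Lip_bs_def)
  then obtain c r where r: "\<And>y. y \<in> supp f \<Longrightarrow> dist c y \<le> r"
    by (auto simp: bounded_def)
  \<comment> \<open>The centre \<open>c\<close> need not lie in the support, and \<open>r\<close>
    may be negative when the support is empty; hence the absolute value.\<close>
  have "\<bar>f x\<bar> \<le> \<bar>f c\<bar> + L * \<bar>r\<bar>" for x
  proof (cases "x \<in> supp f")
    case True
    have "\<bar>f c - f x\<bar> \<le> L * dist c x"
      using lipschitz_onD[OF L, of c x] by (simp add: dist_real_def)
    also have "\<dots> \<le> L * \<bar>r\<bar>"
      using r[OF True] lipschitz_on_nonneg[OF L] by (intro mult_left_mono) auto
    finally show ?thesis by linarith
  next
    case False
    then show ?thesis using lipschitz_on_nonneg[OF L] by (simp add: supp_zero)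
  qed
  then show thesis
    using lipschitz_on_nonneg[OF L] by (intro that[of "\<bar>f c\<bar> + L * \<bar>r\<bar>"]) auto
qed

text \<open>A product of Lipschitz functions is Lipschitz here because both factors are bounded:
  \<open>f\<close> through its bounded support, \<open>\<phi>\<close> by assumption. This is what
  allows a test function to be split with weights \<open>\<phi>\<close> and
  \<open>1 - \<phi>\<close>.\<close>

lemma Lip_bs_mult:
  assumes f: "f \<in> Lip_bs" and \<phi>: "\<phi> \<in> Lip" "\<And>x. 0 \<le> \<phi> x" "\<And>x. \<phi> x \<le> 1"
  shows "(\<lambda>x. f x * \<phi> x) \<in> Lip_bs"
proof -
  obtain L where L: "L-lipschitz_on UNIV f"
    using f by (auto simp: Lip_bs_def Lip_def)
  obtain K where K: "K-lipschitz_on UNIV \<phi>"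
    using \<phi> by (auto simp: Lip_def)
  obtain M where M: "0 \<le> M" "\<And>x. \<bar>f x\<bar> \<le> M"
    using Lip_bs_bounded[OF f] by blast
  have "(M * K + L)-lipschitz_on UNIV (\<lambda>x. f x * \<phi> x)"
  proof (rule lipschitz_onI)
    fix x y :: 'a
    have "\<bar>f x * \<phi> x - f y * \<phi> y\<bar> = \<bar>f x * (\<phi> x - \<phi> y) + \<phi> y * (f x - f y)\<bar>"
      by (simp add: algebra_simps)
    also have "\<dots> \<le> \<bar>f x\<bar> * \<bar>\<phi> x - \<phi> y\<bar> + \<bar>\<phi> y\<bar> * \<bar>f x - f y\<bar>"
      by (metis abs_mult abs_triangle_ineq)
    also have "\<dots> \<le> M * (K * dist x y) + 1 * (L * dist x y)"
      using lipschitz_onD[OF L, of x y] lipschitz_onD[OF K, of x y] M \<phi>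
      by (intro add_mono mult_mono) (auto simp: dist_real_def)
    finally show "dist (f x * \<phi> x) (f y * \<phi> y) \<le> (M * K + L) * dist x y"
      by (simp add: dist_real_def algebra_simps)
  qed (use M lipschitz_on_nonneg[OF L] lipschitz_on_nonneg[OF K] in auto)
  moreover have "supp (\<lambda>x. f x * \<phi> x) \<subseteq> supp f"
    unfolding supp_def by (rule closure_mono) auto
  ultimately show ?thesis
    using f by (auto simp: Lip_bs_def intro: LipI bounded_subset)
qed

section \<open>Sigma-compact sets and bounded Borel sets\<close>

lemma sigma_compact_UN:
  fixes K :: "nat \<Rightarrow> 'a::topological_space set"
  assumes "\<And>n. sigma_compact (K n)"
  shows "sigma_compact (\<Union>n. K n)"
proof -
  have "\<forall>n. \<exists>F. (\<forall>k::nat. compact (F k)) \<and> K n = (\<Union>k. F k)"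
    using assms unfolding sigma_compact_def by simp
  from choice[OF this] obtain F
    where F: "\<forall>n. (\<forall>k::nat. compact (F n k)) \<and> K n = (\<Union>k. F n k)" ..
  define G where "G j = F (fst (prod_decode j)) (snd (prod_decode j))" for j
  have "(\<Union>n. K n) = (\<Union>j. G j)"
  proof (intro equalityI subsetI)
    fix x assume "x \<in> (\<Union>n. K n)"
    then obtain n k where "x \<in> F n k" using F by auto
    then have "x \<in> G (prod_encode (n, k))" by (simp add: G_def)
    then show "x \<in> (\<Union>j. G j)" by (rule UN_I[OF UNIV_I])
  next
    fix x assume "x \<in> (\<Union>j. G j)"
    then show "x \<in> (\<Union>n. K n)" using F by (auto simp: G_def)
  qed
  moreover have "\<forall>j. compact (G j)"
    using F by (simp add: G_def)
  ultimately show ?thesis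
    unfolding sigma_compact_def by (intro exI[of _ G] conjI)
qed

lemma sigma_compact_Un:
  assumes "sigma_compact A" "sigma_compact B"
  shows "sigma_compact (A \<union> B)"
proof -
  have "A \<union> B = (\<Union>n::nat. if n = 0 then A else B)"
    by (auto split: if_splits intro: exI[of _ "Suc 0"])
  then show ?thesis
    using sigma_compact_UN[of "\<lambda>n. if n = 0 then A else B"] assms by (simp split: if_splits)
qed

lemma bounded_borel_subset:
  "A \<in> bounded_borel \<Longrightarrow> B \<in> sets borel \<Longrightarrow> B \<subseteq> A \<Longrightarrow> B \<in> bounded_borel"
  by (auto simp: bounded_borel_def intro: bounded_subset)

lemma bounded_borel_sets: "A \<in> bounded_borel \<Longrightarrow> A \<in> sets borel"
  by (simp add: bounded_borel_def)

lemma bounded_borel_Un: "A \<in> bounded_borel \<Longrightarrow> B \<in> bounded_borel \<Longrightarrow> A \<union> B \<in> bounded_borel"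
  by (auto simp: bounded_borel_def)

lemma bounded_borel_ball: "ball x r \<in> bounded_borel"
  by (auto simp: bounded_borel_def)

lemma bounded_borel_empty: "{} \<in> bounded_borel"
  by (auto simp: bounded_borel_def)

section \<open>Additivity and continuity of nonnegative set functions\<close>

lemma M0b_nonneg_nonneg: "\<mu> \<in> M0b_nonneg \<Longrightarrow> 0 \<le> \<mu> B"
  by (cases "B \<in> bounded_borel") (auto simp: M0b_nonneg_def M0b_def)

lemma M0b_nonneg_outside: "\<mu> \<in> M0b_nonneg \<Longrightarrow> B \<notin> bounded_borel \<Longrightarrow> \<mu> B = 0"
  by (auto simp: M0b_nonneg_def M0b_def)

lemma M0b_nonneg_sums:
  fixes A :: "nat \<Rightarrow> 'a::metric_space set"
  assumes \<mu>: "\<mu> \<in> M0b_nonneg" and A: "range A \<subseteq> sets borel" "disjoint_family A"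
    and U: "(\<Union>n. A n) \<in> bounded_borel"
  shows "(\<lambda>n. \<mu> (A n)) sums \<mu> (\<Union>n. A n)"
proof -
  have "(\<lambda>B. \<mu> ((\<Union>n. A n) \<inter> B)) \<in> M0"
    using \<mu> U by (auto simp: M0b_nonneg_def M0b_def)
  then have "(\<lambda>n. \<mu> ((\<Union>n. A n) \<inter> A n)) sums \<mu> ((\<Union>n. A n) \<inter> (\<Union>n. A n))"
    using A unfolding M0_def signed_borel_measure_def by blast
  moreover have "(\<Union>n. A n) \<inter> A n = A n" for n by auto
  ultimately show ?thesis by simp
qed

lemma M0b_nonneg_empty:
  assumes "\<mu> \<in> M0b_nonneg"
  shows "\<mu> {} = 0"
proof -
  have "(\<lambda>B. \<mu> ({} \<inter> B)) \<in> M0"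
    using assms bounded_borel_empty unfolding M0b_nonneg_def M0b_def by blast
  then show ?thesis by (simp add: M0_def signed_borel_measure_def)
qed

lemma M0b_nonneg_add:
  assumes \<mu>: "\<mu> \<in> M0b_nonneg" and A: "A \<in> bounded_borel" "B \<in> bounded_borel" "A \<inter> B = {}"
  shows "\<mu> (A \<union> B) = \<mu> A + \<mu> B"
proof -
  have "(\<lambda>n. \<mu> (binaryset A B n)) sums \<mu> (\<Union>n. binaryset A B n)"
    using A by (intro M0b_nonneg_sums[OF \<mu>])
      (auto simp: range_binaryset_eq UN_binaryset_eq bounded_borel_Un bounded_borel_sets
        disjoint_family_on_def binaryset_def)
  moreover have "(\<lambda>n. \<mu> (binaryset A B n)) sums (\<mu> A + \<mu> B)"
    by (rule binaryset_sums) (rule M0b_nonneg_empty[OF \<mu>])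
  ultimately show ?thesis
    by (simp add: UN_binaryset_eq sums_unique2)
qed

lemma M0b_nonneg_mono:
  assumes \<mu>: "\<mu> \<in> M0b_nonneg" and B: "B \<in> bounded_borel" and A: "A \<in> sets borel" "A \<subseteq> B"
  shows "\<mu> A \<le> \<mu> B"
proof -
  have "\<mu> (A \<union> (B - A)) = \<mu> A + \<mu> (B - A)"
    using B A by (intro M0b_nonneg_add[OF \<mu>])
      (auto intro: bounded_borel_subset dest: bounded_borel_sets)
  moreover have "A \<union> (B - A) = B" using A by auto
  ultimately show ?thesis using M0b_nonneg_nonneg[OF \<mu>, of "B - A"] by simp
qed

lemma M0b_nonneg_concentrated:
  assumes "\<mu> \<in> M0b_nonneg" "U \<in> bounded_borel"
  obtains K where "sigma_compact K" "\<And>B. B \<in> sets borel \<Longrightarrow> B \<subseteq> U \<Longrightarrow> B \<inter> K = {} \<Longrightarrow> \<mu> B = 0"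
proof -
  have "(\<lambda>B. \<mu> (U \<inter> B)) \<in> M0"
    using assms by (auto simp: M0b_nonneg_def M0b_def)
  then obtain K where K: "sigma_compact K" "concentrated_on (\<lambda>B. \<mu> (U \<inter> B)) K"
    unfolding M0_def by blast
  show thesis
    using K(2) by (intro that[OF K(1)]) (auto simp: concentrated_on_def Int_absorb1)
qed

text \<open>The layers \<open>R n - R (Suc n)\<close> partition \<open>R 0\<close>, so their masses
  sum to \<open>\<mu> (R 0)\<close>; the partial sums telescope to
  \<open>\<mu> (R 0) - \<mu> (R n)\<close>.\<close>

lemma M0b_nonneg_vanishing:
  fixes R :: "nat \<Rightarrow> 'a::metric_space set"
  assumes \<mu>: "\<mu> \<in> M0b_nonneg" and R: "\<And>n. R n \<in> bounded_borel" "decseq R" "(\<Inter>n. R n) = {}"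
  shows "(\<lambda>n. \<mu> (R n)) \<longlonglongrightarrow> 0"
proof -
  define A where "A n = R n - R (Suc n)" for n
  have bA: "A n \<in> bounded_borel" for n
    unfolding A_def using R(1) by (auto intro: bounded_borel_subset dest: bounded_borel_sets)
  have UA: "(\<Union>n. A n) = R 0"
  proof (intro equalityI subsetI)
    fix x assume x: "x \<in> R 0"
    \<comment> \<open>The first index at which \<open>x\<close> has dropped out. It is positive
      since \<open>x \<in> R 0\<close>, so \<open>x\<close> lies in the layer just before
      it.\<close>
    define k where "k = (LEAST n. x \<notin> R n)"
    have ex: "\<exists>n. x \<notin> R n" using R(3) by blast
    then have k: "x \<notin> R k" unfolding k_def by (rule LeastI_ex)
    then obtain j where j: "k = Suc j" using x by (cases k) auto
    have "x \<in> R j" using not_less_Least[of j "\<lambda>n. x \<notin> R n"] j unfolding k_def by auto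
    then show "x \<in> (\<Union>n. A n)" using k j by (auto simp: A_def)
  qed (use R(2) in \<open>auto simp: A_def decseq_def\<close>)
  have "disjoint_family A"
    unfolding disjoint_family_on_def A_def using R(2)
    by (auto simp: decseq_def) (metis linorder_neqE_nat Suc_leI subsetD)
  then have s: "(\<lambda>n. \<mu> (A n)) sums \<mu> (R 0)"
    using M0b_nonneg_sums[OF \<mu>, of A] bA R(1) UA by (auto dest: bounded_borel_sets)
  have step: "\<mu> (A n) = \<mu> (R n) - \<mu> (R (Suc n))" for n
  proof -
    have "\<mu> (A n \<union> R (Suc n)) = \<mu> (A n) + \<mu> (R (Suc n))"
      using bA R(1) by (intro M0b_nonneg_add[OF \<mu>]) (auto simp: A_def)
    moreover have "A n \<union> R (Suc n) = R n"
      using R(2) by (auto simp: A_def decseq_Suc_iff)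
    ultimately show ?thesis by simp
  qed
  have "(\<Sum>i<n. \<mu> (A i)) = \<mu> (R 0) - \<mu> (R n)" for n
    by (induction n) (auto simp: step)
  then have "(\<lambda>n. \<mu> (R 0) - \<mu> (R n)) \<longlonglongrightarrow> \<mu> (R 0)"
    using s by (simp add: sums_def)
  then have "(\<lambda>n. \<mu> (R 0) - (\<mu> (R 0) - \<mu> (R n))) \<longlonglongrightarrow> \<mu> (R 0) - \<mu> (R 0)"
    by (intro tendsto_diff tendsto_const)
  then show ?thesis by simp
qed

text \<open>For real-valued set functions, finite additivity together with continuity at the empty
  set gives countable additivity. In this form the conditions pass easily to infima and series: a
  squeeze or dominated convergence replaces the rearrangement of double sums.\<close>

lemma M0b_nonnegI:
  fixes \<mu> :: "'a::metric_space set \<Rightarrow> real"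
  assumes nonneg: "\<And>B. B \<in> bounded_borel \<Longrightarrow> 0 \<le> \<mu> B"
    and outside: "\<And>B. B \<notin> bounded_borel \<Longrightarrow> \<mu> B = 0"
    and add: "\<And>A B. A \<in> bounded_borel \<Longrightarrow> B \<in> bounded_borel \<Longrightarrow> A \<inter> B = {} \<Longrightarrow>
      \<mu> (A \<union> B) = \<mu> A + \<mu> B"
    and van: "\<And>R. (\<And>n::nat. R n \<in> bounded_borel) \<Longrightarrow> decseq R \<Longrightarrow> (\<Inter>n. R n) = {} \<Longrightarrow>
      (\<lambda>n. \<mu> (R n)) \<longlonglongrightarrow> 0"
    and conc: "\<And>U. U \<in> bounded_borel \<Longrightarrow>
      \<exists>K. sigma_compact K \<and> (\<forall>B\<in>sets borel. B \<subseteq> U \<longrightarrow> B \<inter> K = {} \<longrightarrow> \<mu> B = 0)"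
  shows "\<mu> \<in> M0b_nonneg"
proof -
  have empty: "\<mu> {} = 0"
    using add[OF bounded_borel_empty bounded_borel_empty] by simp
  have "(\<lambda>B. \<mu> (U \<inter> B)) \<in> M0" if U: "U \<in> bounded_borel" for U
  proof -
    have "(\<lambda>n. \<mu> (U \<inter> A n)) sums \<mu> (U \<inter> (\<Union>n. A n))"
      if A: "range A \<subseteq> sets borel" "disjoint_family A" for A :: "nat \<Rightarrow> 'a set"
    proof -
      have sA: "A n \<in> sets borel" for n using A by auto
      \<comment> \<open>Tails of the union inside \<open>U\<close>. Finite additivity splits off one
        member at a time, and disjointness leaves no point common to all tails.\<close>
      define R where "R n = U \<inter> (\<Union>i\<in>{n..}. A i)" for n
      have bR: "R n \<in> bounded_borel" for n
        unfolding R_def using U sA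
        by (intro bounded_borel_subset[OF U] sets.Int bounded_borel_sets[OF U] sets.countable_UN')
          auto
      have bA: "U \<inter> A n \<in> bounded_borel" for n
        using U sA by (auto intro: bounded_borel_subset dest: bounded_borel_sets)
      have dec: "decseq R"
        unfolding R_def decseq_def by (auto intro: order_trans)
      have "x \<notin> (\<Inter>n. R n)" for x
      proof
        assume x: "x \<in> (\<Inter>n. R n)"
        then obtain i where "x \<in> A i" by (auto simp: R_def)
        moreover from x have "x \<in> R (Suc i)" by blast
        ultimately show False using A(2)
          by (auto simp: R_def disjoint_family_on_def) (metis Suc_n_not_le_n disjoint_iff UNIV_I)
      qed
      then have "(\<Inter>n. R n) = {}" by blast
      with van[OF bR dec] have lim: "(\<lambda>n. \<mu> (R n)) \<longlonglongrightarrow> 0" by blast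
      have "\<mu> (R 0) = (\<Sum>i<n. \<mu> (U \<inter> A i)) + \<mu> (R n)" for n
      proof (induction n)
        case (Suc n)
        have "{n..} = insert n {Suc n..}" by auto
        then have "R n = (U \<inter> A n) \<union> R (Suc n)"
          by (auto simp: R_def)
        moreover have "(U \<inter> A n) \<inter> R (Suc n) = {}"
          using A(2) unfolding R_def disjoint_family_on_def
          by (auto simp: disjoint_iff) (metis Suc_n_not_le_n)
        ultimately have "\<mu> (R n) = \<mu> (U \<inter> A n) + \<mu> (R (Suc n))"
          using add[OF bA bR] by metis
        then show ?case using Suc by simp
      qed simp
      then have "(\<Sum>i<n. \<mu> (U \<inter> A i)) = \<mu> (R 0) - \<mu> (R n)" for n
        by (simp add: algebra_simps)
      moreover have "(\<lambda>n. \<mu> (R 0) - \<mu> (R n)) \<longlonglongrightarrow> \<mu> (R 0) - 0"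
        by (intro tendsto_diff tendsto_const lim)
      moreover have "R 0 = U \<inter> (\<Union>n. A n)" by (auto simp: R_def)
      ultimately show ?thesis by (simp add: sums_def)
    qed
    moreover obtain K where "sigma_compact K"
      "\<And>B. B \<in> sets borel \<Longrightarrow> B \<subseteq> U \<Longrightarrow> B \<inter> K = {} \<Longrightarrow> \<mu> B = 0"
      using conc[OF U] by blast
    moreover from this have "concentrated_on (\<lambda>B. \<mu> (U \<inter> B)) K"
      using bounded_borel_sets[OF U] unfolding concentrated_on_def
      by (metis Int_lower1 inf_assoc inf_bot_right sets.Int)
    ultimately show ?thesis
      using empty unfolding M0_def signed_borel_measure_def by auto
  qed
  then show ?thesis
    using nonneg outside by (auto simp: M0b_nonneg_def M0b_def)
qed

section \<open>Sums, series and patches of measures\<close>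

lemma M0b_nonneg_plus:
  assumes \<mu>: "\<mu> \<in> M0b_nonneg" and \<nu>: "\<nu> \<in> M0b_nonneg"
  shows "(\<lambda>B. \<mu> B + \<nu> B) \<in> M0b_nonneg"
proof (rule M0b_nonnegI)
  fix R :: "nat \<Rightarrow> 'a set"
  assume "\<And>n. R n \<in> bounded_borel" "decseq R" "(\<Inter>n. R n) = {}"
  then show "(\<lambda>n. \<mu> (R n) + \<nu> (R n)) \<longlonglongrightarrow> 0"
    using tendsto_add[OF M0b_nonneg_vanishing[OF \<mu>] M0b_nonneg_vanishing[OF \<nu>], of R R] by simp
next
  fix U :: "'a set" assume U: "U \<in> bounded_borel"
  obtain K where K: "sigma_compact K" "\<And>B. B \<in> sets borel \<Longrightarrow> B \<subseteq> U \<Longrightarrow> B \<inter> K = {} \<Longrightarrow> \<mu> B = 0"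
    using M0b_nonneg_concentrated[OF \<mu> U] by blast
  obtain L where L: "sigma_compact L" "\<And>B. B \<in> sets borel \<Longrightarrow> B \<subseteq> U \<Longrightarrow> B \<inter> L = {} \<Longrightarrow> \<nu> B = 0"
    using M0b_nonneg_concentrated[OF \<nu> U] by blast
  show "\<exists>K. sigma_compact K \<and> (\<forall>B\<in>sets borel. B \<subseteq> U \<longrightarrow> B \<inter> K = {} \<longrightarrow> \<mu> B + \<nu> B = 0)"
    using K L by (intro exI[of _ "K \<union> L"]) (auto simp: sigma_compact_Un Int_Un_distrib)
qed (use \<mu> \<nu> in \<open>auto simp: M0b_nonneg_nonneg M0b_nonneg_outside M0b_nonneg_add\<close>)

lemma M0b_nonneg_zero: "(\<lambda>B. 0) \<in> M0b_nonneg"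
proof (rule M0b_nonnegI)
  have "sigma_compact {}"
    unfolding sigma_compact_def by (intro exI[of _ "\<lambda>n. {}"]) auto
  then show "\<exists>K. sigma_compact K \<and> (\<forall>B\<in>sets borel. B \<subseteq> U \<longrightarrow> B \<inter> K = {} \<longrightarrow> (0::real) = 0)"
    for U :: "'a set" by blast
qed auto

text \<open>Continuity at the empty set is dominated convergence for series:
  \<open>\<mu> k (R n)\<close> is at most \<open>\<mu> k (R 0)\<close>, which is summable in
  \<open>k\<close>. The union of the countably many concentration sets is again
  sigma-compact.\<close>

lemma M0b_nonneg_suminf:
  fixes \<mu> :: "nat \<Rightarrow> 'a::metric_space set \<Rightarrow> real"
  assumes \<mu>: "\<And>k. \<mu> k \<in> M0b_nonneg" and sm: "\<And>B. B \<in> bounded_borel \<Longrightarrow> summable (\<lambda>k. \<mu> k B)"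
  shows "(\<lambda>B. \<Sum>k. \<mu> k B) \<in> M0b_nonneg"
proof (rule M0b_nonnegI)
  fix R :: "nat \<Rightarrow> 'a set"
  assume R: "\<And>n. R n \<in> bounded_borel" "decseq R" "(\<Inter>n. R n) = {}"
  have "((\<lambda>n. \<Sum>k. \<mu> k (R n)) \<longlongrightarrow> (\<Sum>k::nat. 0)) sequentially"
  proof (rule tannerys_theorem[THEN conjunct2, THEN conjunct2])
    show "(\<lambda>n. \<mu> k (R n)) \<longlonglongrightarrow> 0" for k
      using M0b_nonneg_vanishing[OF \<mu> R] .
    have "R n \<subseteq> R 0" for n using R(2) by (auto simp: decseq_def)
    then have "norm (\<mu> k (R n)) \<le> \<mu> k (R 0)" for k n
      using M0b_nonneg_mono[OF \<mu> R(1)] R(1) M0b_nonneg_nonneg[OF \<mu>]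
      by (simp add: bounded_borel_sets)
    then show "\<forall>\<^sub>F (k, n) in sequentially \<times>\<^sub>F sequentially. norm (\<mu> k (R n)) \<le> \<mu> k (R 0)"
      by (intro always_eventually) auto
  qed (use sm R in auto)
  then show "(\<lambda>n. \<Sum>k. \<mu> k (R n)) \<longlonglongrightarrow> 0" by simp
next
  fix U :: "'a set" assume U: "U \<in> bounded_borel"
  have "\<forall>k. \<exists>K. sigma_compact K \<and>
      (\<forall>B\<in>sets borel. B \<subseteq> U \<longrightarrow> B \<inter> K = {} \<longrightarrow> \<mu> k B = 0)"
    using M0b_nonneg_concentrated[OF \<mu> U] by metis
  from choice[OF this] obtain K where K: "\<And>k. sigma_compact (K k)"
    "\<And>k B. B \<in> sets borel \<Longrightarrow> B \<subseteq> U \<Longrightarrow> B \<inter> K k = {} \<Longrightarrow> \<mu> k B = 0" by blast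
  have "(\<Sum>k. \<mu> k B) = 0" if "B \<in> sets borel" "B \<subseteq> U" "B \<inter> (\<Union>k. K k) = {}" for B
  proof -
    have "\<mu> k B = 0" for k using that by (intro K(2)) auto
    then show ?thesis by simp
  qed
  then show "\<exists>K. sigma_compact K \<and> (\<forall>B\<in>sets borel. B \<subseteq> U \<longrightarrow> B \<inter> K = {} \<longrightarrow> (\<Sum>k. \<mu> k B) = 0)"
    using sigma_compact_UN[of K, OF K(1)] by blast
qed (use \<mu> sm in \<open>auto simp: M0b_nonneg_outside M0b_nonneg_add suminf_add
      intro!: suminf_nonneg M0b_nonneg_nonneg[OF \<mu>]\<close>)

text \<open>The case distinction matters: \<open>B \<inter> P\<close> or \<open>B - P\<close> can be
  bounded although \<open>B\<close> is not, so the bare sum would violate the convention that set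
  functions vanish off the bounded Borel sets.\<close>

definition patch :: "'a::metric_space set \<Rightarrow> ('a set \<Rightarrow> real) \<Rightarrow> ('a set \<Rightarrow> real) \<Rightarrow> 'a set \<Rightarrow> real" where
  "patch P \<mu> \<nu> B = (if B \<in> bounded_borel then \<mu> (B \<inter> P) + \<nu> (B - P) else 0)"

lemma bounded_borel_Int: "B \<in> bounded_borel \<Longrightarrow> P \<in> sets borel \<Longrightarrow> B \<inter> P \<in> bounded_borel"
  by (auto intro: bounded_borel_subset dest: bounded_borel_sets)

lemma bounded_borel_Diff: "B \<in> bounded_borel \<Longrightarrow> P \<in> sets borel \<Longrightarrow> B - P \<in> bounded_borel"
  by (auto intro: bounded_borel_subset dest: bounded_borel_sets)

lemma M0b_nonneg_patch:
  assumes \<mu>: "\<mu> \<in> M0b_nonneg" and \<nu>: "\<nu> \<in> M0b_nonneg" and P: "P \<in> sets borel"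
  shows "patch P \<mu> \<nu> \<in> M0b_nonneg"
proof (rule M0b_nonnegI)
  fix A B :: "'a set" assume *: "A \<in> bounded_borel" "B \<in> bounded_borel" "A \<inter> B = {}"
  have "\<mu> (A \<inter> P \<union> B \<inter> P) = \<mu> (A \<inter> P) + \<mu> (B \<inter> P)"
    using * P by (intro M0b_nonneg_add[OF \<mu>] bounded_borel_Int) auto
  moreover have "\<nu> ((A - P) \<union> (B - P)) = \<nu> (A - P) + \<nu> (B - P)"
    using * P by (intro M0b_nonneg_add[OF \<nu>] bounded_borel_Diff) auto
  ultimately show "patch P \<mu> \<nu> (A \<union> B) = patch P \<mu> \<nu> A + patch P \<mu> \<nu> B"
    using * by (simp add: patch_def bounded_borel_Un Int_Un_distrib2 Un_Diff)
next
  fix R :: "nat \<Rightarrow> 'a set"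
  assume R: "\<And>n. R n \<in> bounded_borel" "decseq R" "(\<Inter>n. R n) = {}"
  have "(\<lambda>n. \<mu> (R n \<inter> P)) \<longlonglongrightarrow> 0"
    using R P by (intro M0b_nonneg_vanishing[OF \<mu>] bounded_borel_Int) (auto simp: decseq_def)
  moreover have "(\<lambda>n. \<nu> (R n - P)) \<longlonglongrightarrow> 0"
    using R P by (intro M0b_nonneg_vanishing[OF \<nu>] bounded_borel_Diff) (auto simp: decseq_def)
  ultimately show "(\<lambda>n. patch P \<mu> \<nu> (R n)) \<longlonglongrightarrow> 0"
    using tendsto_add[of "\<lambda>n. \<mu> (R n \<inter> P)" 0 sequentially "\<lambda>n. \<nu> (R n - P)" 0]
    by (simp add: patch_def R)
next
  fix U :: "'a set" assume U: "U \<in> bounded_borel"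
  obtain K where K: "sigma_compact K" "\<And>B. B \<in> sets borel \<Longrightarrow> B \<subseteq> U \<Longrightarrow> B \<inter> K = {} \<Longrightarrow> \<mu> B = 0"
    using M0b_nonneg_concentrated[OF \<mu> U] by blast
  obtain L where L: "sigma_compact L" "\<And>B. B \<in> sets borel \<Longrightarrow> B \<subseteq> U \<Longrightarrow> B \<inter> L = {} \<Longrightarrow> \<nu> B = 0"
    using M0b_nonneg_concentrated[OF \<nu> U] by blast
  have "patch P \<mu> \<nu> B = 0" if B: "B \<in> sets borel" "B \<subseteq> U" "B \<inter> (K \<union> L) = {}" for B
  proof -
    have "\<mu> (B \<inter> P) = 0" using B P by (intro K(2)) auto
    moreover have "\<nu> (B - P) = 0" using B P by (intro L(2)) auto
    ultimately show ?thesis by (simp add: patch_def)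
  qed
  then show "\<exists>K. sigma_compact K \<and> (\<forall>B\<in>sets borel. B \<subseteq> U \<longrightarrow> B \<inter> K = {} \<longrightarrow> patch P \<mu> \<nu> B = 0)"
    using sigma_compact_Un[OF K(1) L(1)] by blast
qed (use \<mu> \<nu> in \<open>auto simp: patch_def M0b_nonneg_nonneg\<close>)

section \<open>Integration against the Borel extension\<close>

lemma sets_borel_extension [simp, measurable_cong]: "sets (borel_extension \<mu>) = sets borel"
  unfolding borel_extension_def using sets.sigma_sets_eq[of borel] by simp

lemma space_borel_extension [simp]: "space (borel_extension \<mu>) = UNIV"
  by (simp add: borel_extension_def)

lemma bounded_subset_nat_ball:
  assumes "bounded U"
  obtains n :: nat where "U \<subseteq> ball c (real n)"
proof -
  obtain r where r: "\<And>y. y \<in> U \<Longrightarrow> dist c y \<le> r"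
    using assms by (auto simp: bounded_any_center[where a = c])
  obtain n :: nat where "r < real n" using reals_Archimedean2 by blast
  then have "U \<subseteq> ball c (real n)" using r by force
  then show thesis by (rule that)
qed

text \<open>Concentric balls exhaust the space, so a Borel measure is determined by its values on
  bounded Borel sets. Identities between extensions are therefore checked on bounded sets and
  carried over by this supremum.\<close>

lemma emeasure_SUP_nat_ball:
  assumes M: "sets M = sets borel" and B: "B \<in> sets borel"
  shows "emeasure M B = (SUP n. emeasure M (ball c (real n) \<inter> B))"
proof -
  have "range (\<lambda>n. ball c (real n) \<inter> B) \<subseteq> sets M"
    using B by (auto simp: M)
  moreover have "incseq (\<lambda>n. ball c (real n) \<inter> B)"
    by (auto simp: incseq_def)
  moreover have "(\<Union>n. ball c (real n) \<inter> B) = B"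
    using reals_Archimedean2 by auto
  ultimately show ?thesis
    using SUP_emeasure_incseq[of "\<lambda>n. ball c (real n) \<inter> B" M] by simp
qed

text \<open>The formula behind \<open>borel_extension\<close> has to be shown countably additive
  before it can be evaluated. The supremum over all bounded Borel sets equals the one along balls of
  natural radius, and an increasing supremum commutes with a series. On a bounded \<open>B\<close>
  the supremum is attained at \<open>U = B\<close>.\<close>

lemma emeasure_borel_extension:
  assumes \<mu>: "\<mu> \<in> M0b_nonneg" and B: "B \<in> bounded_borel"
  shows "emeasure (borel_extension \<mu>) B = ennreal (\<mu> B)"
proof -
  define \<mu>' where "\<mu>' B = (SUP U\<in>bounded_borel. ennreal (\<mu> (U \<inter> B)))" for B
  \<comment> \<open>Any centre will do, and types are inhabited.\<close>
  define c :: 'a where "c = undefined"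
  have ball: "\<mu>' B = (SUP n. ennreal (\<mu> (ball c (real n) \<inter> B)))" if B: "B \<in> sets borel" for B
    unfolding \<mu>'_def
  proof (rule antisym; rule SUP_least)
    fix U :: "'a set" assume U: "U \<in> bounded_borel"
    then obtain n :: nat where n: "U \<subseteq> ball c (real n)"
      using bounded_subset_nat_ball by (auto simp: bounded_borel_def)
    have "\<mu> (U \<inter> B) \<le> \<mu> (ball c (real n) \<inter> B)"
      using U B n
      by (intro M0b_nonneg_mono[OF \<mu>] bounded_borel_Int bounded_borel_ball)
        (auto simp: bounded_borel_sets)
    then show "ennreal (\<mu> (U \<inter> B)) \<le> (SUP n. ennreal (\<mu> (ball c (real n) \<inter> B)))"
      by (intro SUP_upper2[of n] ennreal_leI) auto
  qed (auto intro!: SUP_upper2[OF bounded_borel_ball])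
  have "(SUP U\<in>bounded_borel :: 'a set set. 0 :: ennreal) = 0"
    by (rule SUP_const) (use bounded_borel_empty in blast)
  then have "positive (sets borel) \<mu>'"
    by (simp add: positive_def \<mu>'_def M0b_nonneg_empty[OF \<mu>])
  moreover have "countably_additive (sets borel) \<mu>'"
  proof (rule countably_additiveI)
    fix A :: "nat \<Rightarrow> 'a set"
    assume A: "range A \<subseteq> sets borel" "disjoint_family A" "(\<Union>i. A i) \<in> sets borel"
    have sA: "A i \<in> sets borel" for i using A by auto
    have "(\<Sum>i. \<mu>' (A i)) = (\<Sum>i. SUP n. ennreal (\<mu> (ball c (real n) \<inter> A i)))"
      using sA by (simp add: ball)
    also have "\<dots> = (SUP n. \<Sum>i. ennreal (\<mu> (ball c (real n) \<inter> A i)))"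
    proof (rule ennreal_suminf_SUP_eq)
      fix i
      show "incseq (\<lambda>n. ennreal (\<mu> (ball c (real n) \<inter> A i)))"
        unfolding incseq_def using sA
        by (auto intro!: ennreal_leI M0b_nonneg_mono[OF \<mu>] bounded_borel_Int bounded_borel_ball)
    qed
    also have "\<dots> = (SUP n. ennreal (\<mu> (ball c (real n) \<inter> (\<Union>i. A i))))"
    proof (rule SUP_cong[OF refl])
      fix n :: nat
      have "(\<Union>i. ball c (real n) \<inter> A i) = ball c (real n) \<inter> (\<Union>i. A i)" by auto
      moreover have "ball c (real n) \<inter> (\<Union>i. A i) \<in> bounded_borel"
        using A(3) by (intro bounded_borel_Int bounded_borel_ball)
      moreover have "range (\<lambda>i. ball c (real n) \<inter> A i) \<subseteq> sets borel"
        using sA by auto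
      moreover have "disjoint_family (\<lambda>i. ball c (real n) \<inter> A i)"
        using A(2) by (auto simp: disjoint_family_on_def)
      ultimately have "(\<lambda>i. \<mu> (ball c (real n) \<inter> A i)) sums \<mu> (ball c (real n) \<inter> (\<Union>i. A i))"
        using M0b_nonneg_sums[OF \<mu>, of "\<lambda>i. ball c (real n) \<inter> A i"] by simp
      then show "(\<Sum>i. ennreal (\<mu> (ball c (real n) \<inter> A i))) =
          ennreal (\<mu> (ball c (real n) \<inter> (\<Union>i. A i)))"
        by (intro suminf_ennreal_eq M0b_nonneg_nonneg[OF \<mu>])
    qed
    also have "\<dots> = \<mu>' (\<Union>i. A i)" using A(3) by (simp add: ball)
    finally show "(\<Sum>i. \<mu>' (A i)) = \<mu>' (\<Union>i. A i)" .
  qed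
  moreover have "borel_extension \<mu> = measure_of UNIV (sets borel) \<mu>'"
    unfolding borel_extension_def \<mu>'_def ..
  moreover have "sigma_algebra (UNIV :: 'a set) (sets borel)"
    using sets.sigma_algebra_axioms[of borel] by simp
  ultimately have "emeasure (borel_extension \<mu>) B = \<mu>' B"
    using B by (simp add: emeasure_measure_of_sigma bounded_borel_sets)
  also have "\<dots> = ennreal (\<mu> B)"
    unfolding \<mu>'_def
  proof (rule antisym; (rule SUP_least)?)
    show "ennreal (\<mu> B) \<le> (SUP U\<in>bounded_borel. ennreal (\<mu> (U \<inter> B)))"
      using B by (intro SUP_upper2[of B]) auto
  qed (use B in \<open>auto intro!: ennreal_leI M0b_nonneg_mono[OF \<mu>] dest: bounded_borel_sets\<close>)
  finally show ?thesis .
qed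

text \<open>Additivity in the measure instead of the integrand. It holds for indicators by
  assumption and passes to multiples, sums and increasing limits; the common sigma-algebra makes
  measurability the same for all three measures.\<close>

lemma nn_integral_add_measure:
  assumes sets: "sets M = sets N" "sets M' = sets N"
    and em: "\<And>A. A \<in> sets N \<Longrightarrow> emeasure N A = emeasure M A + emeasure M' A"
    and f: "f \<in> borel_measurable N"
  shows "(\<integral>\<^sup>+x. f x \<partial>N) = (\<integral>\<^sup>+x. f x \<partial>M) + (\<integral>\<^sup>+x. f x \<partial>M')"
proof -
  note [measurable_cong] = sets
  have sp: "space M = space N" "space M' = space N"
    using sets sets_eq_imp_space_eq by blast+
  show ?thesis
    using f
  proof induction
    case (cong f g)
    then have "integral\<^sup>N K f = integral\<^sup>N K g" if "space K = space N" for K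
      using that by (intro nn_integral_cong) auto
    then show ?case using cong sp by simp
  next
    case (seq U)
    have [measurable]: "\<And>i. U i \<in> borel_measurable N" by fact
    have "integral\<^sup>N K (SUP i. U i) = (SUP i. integral\<^sup>N K (U i))" if "sets K = sets N" for K
    proof -
      have "(SUP i. U i) = (\<lambda>x. SUP i. U i x)" by (auto simp: fun_eq_iff image_comp)
      moreover have "U i \<in> borel_measurable K" for i
        using that by (simp cong: measurable_cong_sets)
      ultimately show ?thesis
        using nn_integral_monotone_convergence_SUP[OF \<open>incseq U\<close>, of K] by simp
    qed
    moreover have "incseq (\<lambda>i. integral\<^sup>N K (U i))" for K
      using \<open>incseq U\<close> by (auto simp: incseq_def le_fun_def intro!: nn_integral_mono)
    ultimately show ?case
      using sets seq.IH by (simp add: ennreal_SUP_add del: Sup_apply SUP_apply)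
  qed (auto simp: em sets nn_integral_cmult nn_integral_add distrib_left ac_simps
      cong: measurable_cong_sets)
qed

text \<open>The induction is the one used for two measures; in the limit step the series is
  exchanged with an increasing supremum.\<close>

lemma nn_integral_suminf_measure:
  assumes sets: "\<And>k. sets (M k) = sets N"
    and em: "\<And>A. A \<in> sets N \<Longrightarrow> emeasure N A = (\<Sum>k. emeasure (M k) A)"
    and f: "f \<in> borel_measurable N"
  shows "(\<integral>\<^sup>+x. f x \<partial>N) = (\<Sum>k. \<integral>\<^sup>+x. f x \<partial>M k)"
proof -
  note [measurable_cong] = sets
  have sp: "space (M k) = space N" for k
    using sets sets_eq_imp_space_eq by blast
  show ?thesis
    using f
  proof induction
    case (cong f g)
    then have "integral\<^sup>N K f = integral\<^sup>N K g" if "space K = space N" for K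
      using that by (intro nn_integral_cong) auto
    then show ?case using cong sp by simp
  next
    case (add u v)
    have [measurable]: "u \<in> borel_measurable N" "v \<in> borel_measurable N" by fact+
    show ?case
      using add.IH by (simp add: nn_integral_add suminf_add[symmetric])
  next
    case (seq U)
    have [measurable]: "\<And>i. U i \<in> borel_measurable N" by fact
    have *: "integral\<^sup>N K (SUP i. U i) = (SUP i. integral\<^sup>N K (U i))" if "sets K = sets N" for K
    proof -
      have "(SUP i. U i) = (\<lambda>x. SUP i. U i x)" by (auto simp: fun_eq_iff image_comp)
      moreover have "U i \<in> borel_measurable K" for i
        using that by (simp cong: measurable_cong_sets)
      ultimately show ?thesis
        using nn_integral_monotone_convergence_SUP[OF \<open>incseq U\<close>, of K] by simp
    qed
    have "incseq (\<lambda>i. integral\<^sup>N K (U i))" for K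
      using \<open>incseq U\<close> by (auto simp: incseq_def le_fun_def intro!: nn_integral_mono)
    then have "(\<Sum>k. SUP i. integral\<^sup>N (M k) (U i)) = (SUP i. \<Sum>k. integral\<^sup>N (M k) (U i))"
      by (intro ennreal_suminf_SUP_eq)
    then show ?case
      using *[OF sets] *[OF refl] seq.IH by (simp del: Sup_apply SUP_apply)
  qed (auto simp: em sets nn_integral_cmult cong: measurable_cong_sets)
qed

text \<open>The sum enters as a third set function \<open>\<kappa>\<close> with an equation on
  bounded sets only, so that the lemma also applies to the masses of \<open>S\<close>,
  \<open>T - S\<close> and \<open>T\<close>, where additivity is a hypothesis and not the
  definition.\<close>

lemma emeasure_borel_extension_plus:
  assumes \<mu>: "\<mu> \<in> M0b_nonneg" and \<nu>: "\<nu> \<in> M0b_nonneg" and \<kappa>: "\<kappa> \<in> M0b_nonneg"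
    and eq: "\<And>B. B \<in> bounded_borel \<Longrightarrow> \<kappa> B = \<mu> B + \<nu> B" and B: "B \<in> sets borel"
  shows "emeasure (borel_extension \<kappa>) B = emeasure (borel_extension \<mu>) B + emeasure (borel_extension \<nu>) B"
proof -
  define D where "D n = ball undefined (real n) \<inter> B" for n
  have D: "D n \<in> bounded_borel" for n
    unfolding D_def by (intro bounded_borel_Int bounded_borel_ball B)
  have "emeasure (borel_extension \<kappa>) B = (SUP n. ennreal (\<mu> (D n)) + ennreal (\<nu> (D n)))"
    using D by (subst emeasure_SUP_nat_ball[OF sets_borel_extension B, of _ undefined])
      (simp add: emeasure_borel_extension[OF \<kappa>] eq D_def[symmetric] M0b_nonneg_nonneg[OF \<mu>]
        M0b_nonneg_nonneg[OF \<nu>] ennreal_plus)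
  also have "\<dots> = (SUP n. ennreal (\<mu> (D n))) + (SUP n. ennreal (\<nu> (D n)))"
  proof (rule ennreal_SUP_add)
    have "incseq D" by (auto simp: D_def incseq_def)
    then show "incseq (\<lambda>n. ennreal (\<mu> (D n)))" "incseq (\<lambda>n. ennreal (\<nu> (D n)))"
      using D bounded_borel_sets[OF D]
      by (auto simp: incseq_def intro!: ennreal_leI M0b_nonneg_mono[OF \<mu>] M0b_nonneg_mono[OF \<nu>])
  qed
  also have "\<dots> = emeasure (borel_extension \<mu>) B + emeasure (borel_extension \<nu>) B"
    using D by (simp add: emeasure_SUP_nat_ball[OF sets_borel_extension B, of _ undefined]
        emeasure_borel_extension[OF \<mu>] emeasure_borel_extension[OF \<nu>] D_def[symmetric])
  finally show ?thesis .
qed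

lemma nn_integral_borel_extension_plus:
  assumes \<mu>: "\<mu> \<in> M0b_nonneg" and \<nu>: "\<nu> \<in> M0b_nonneg" and f: "f \<in> borel_measurable borel"
  shows "(\<integral>\<^sup>+x. f x \<partial>borel_extension (\<lambda>B. \<mu> B + \<nu> B)) =
    (\<integral>\<^sup>+x. f x \<partial>borel_extension \<mu>) + (\<integral>\<^sup>+x. f x \<partial>borel_extension \<nu>)"
  using f by (intro nn_integral_add_measure)
    (auto intro!: emeasure_borel_extension_plus \<mu> \<nu> M0b_nonneg_plus)

lemma nn_integral_borel_extension_suminf:
  assumes \<mu>: "\<And>k. \<mu> k \<in> M0b_nonneg" and sm: "\<And>B. B \<in> bounded_borel \<Longrightarrow> summable (\<lambda>k. \<mu> k B)"
    and f: "f \<in> borel_measurable borel"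
  shows "(\<integral>\<^sup>+x. f x \<partial>borel_extension (\<lambda>B. \<Sum>k. \<mu> k B)) = (\<Sum>k. \<integral>\<^sup>+x. f x \<partial>borel_extension (\<mu> k))"
proof (rule nn_integral_suminf_measure)
  fix B :: "'a set" assume "B \<in> sets (borel_extension (\<lambda>B. \<Sum>k. \<mu> k B))"
  then have B: "B \<in> sets borel" by simp
  define D where "D n = ball undefined (real n) \<inter> B" for n
  have D: "D n \<in> bounded_borel" for n
    unfolding D_def by (intro bounded_borel_Int bounded_borel_ball B)
  have "emeasure (borel_extension (\<lambda>B. \<Sum>k. \<mu> k B)) B = (SUP n. ennreal (\<Sum>k. \<mu> k (D n)))"
    using D by (simp add: emeasure_SUP_nat_ball[OF sets_borel_extension B, of _ undefined]
      emeasure_borel_extension[OF M0b_nonneg_suminf[OF \<mu> sm]] D_def[symmetric])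
  also have "\<dots> = (SUP n. \<Sum>k. ennreal (\<mu> k (D n)))"
    using suminf_ennreal2[OF M0b_nonneg_nonneg[OF \<mu>] sm[OF D]] by simp
  also have "\<dots> = (\<Sum>k. SUP n. ennreal (\<mu> k (D n)))"
  proof (rule ennreal_suminf_SUP_eq[symmetric])
    have "incseq D" by (auto simp: D_def incseq_def)
    then show "incseq (\<lambda>n. ennreal (\<mu> k (D n)))" for k
      using D bounded_borel_sets[OF D]
      by (auto simp: incseq_def intro!: ennreal_leI M0b_nonneg_mono[OF \<mu>])
  qed
  also have "\<dots> = (\<Sum>k. emeasure (borel_extension (\<mu> k)) B)"
    using D by (simp add: emeasure_SUP_nat_ball[OF sets_borel_extension B, of _ undefined]
        emeasure_borel_extension[OF \<mu>] D_def[symmetric])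
  finally show "emeasure (borel_extension (\<lambda>B. \<Sum>k. \<mu> k B)) B =
      (\<Sum>k. emeasure (borel_extension (\<mu> k)) B)" .
qed (use f in auto)

text \<open>The patch is the sum of the two extensions restricted to \<open>P\<close> and to its
  complement, and restriction is a density with an indicator; so additivity in the measure
  applies.\<close>

lemma nn_integral_borel_extension_patch:
  assumes \<mu>: "\<mu> \<in> M0b_nonneg" and \<nu>: "\<nu> \<in> M0b_nonneg" and P: "P \<in> sets borel"
    and f: "f \<in> borel_measurable borel"
  shows "(\<integral>\<^sup>+x. f x \<partial>borel_extension (patch P \<mu> \<nu>)) =
    (\<integral>\<^sup>+x. f x * indicator P x \<partial>borel_extension \<mu>) + (\<integral>\<^sup>+x. f x * indicator (- P) x \<partial>borel_extension \<nu>)"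
proof -
  let ?M = "density (borel_extension \<mu>) (indicator P)"
  let ?N = "density (borel_extension \<nu>) (indicator (- P))"
  have P': "- P \<in> sets borel" using P by auto
  have M: "emeasure ?M B = emeasure (borel_extension \<mu>) (B \<inter> P)" if "B \<in> sets borel" for B
    using P that by (subst emeasure_restricted) (auto simp: Int_commute)
  have N: "emeasure ?N B = emeasure (borel_extension \<nu>) (B - P)" if "B \<in> sets borel" for B
    using P' that by (subst emeasure_restricted) (auto simp: Diff_eq Int_commute)
  have "(\<integral>\<^sup>+x. f x \<partial>borel_extension (patch P \<mu> \<nu>)) = (\<integral>\<^sup>+x. f x \<partial>?M) + (\<integral>\<^sup>+x. f x \<partial>?N)"
  proof (rule nn_integral_add_measure)
    fix B assume "B \<in> sets (borel_extension (patch P \<mu> \<nu>))"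
    then have B: "B \<in> sets borel" by simp
    define D where "D n = ball undefined (real n) \<inter> B" for n
    have D: "D n \<in> bounded_borel" for n
      unfolding D_def by (intro bounded_borel_Int bounded_borel_ball B)
    have inc: "incseq D" by (auto simp: D_def incseq_def)
    have "emeasure (borel_extension (patch P \<mu> \<nu>)) B = (SUP n. ennreal (patch P \<mu> \<nu> (D n)))"
      using D by (simp add: emeasure_SUP_nat_ball[OF sets_borel_extension B, of _ undefined]
        emeasure_borel_extension[OF M0b_nonneg_patch[OF \<mu> \<nu> P]] D_def[symmetric])
    also have "\<dots> = (SUP n. emeasure ?M (D n) + emeasure ?N (D n))"
      using D P by (simp add: M N patch_def bounded_borel_sets emeasure_borel_extension \<mu> \<nu>
          bounded_borel_Int bounded_borel_Diff ennreal_plus M0b_nonneg_nonneg)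
    also have "\<dots> = (SUP n. emeasure ?M (D n)) + (SUP n. emeasure ?N (D n))"
      using inc bounded_borel_sets[OF D]
      by (intro ennreal_SUP_add) (auto simp: incseq_def intro!: emeasure_mono)
    also have "\<dots> = emeasure ?M B + emeasure ?N B"
      using emeasure_SUP_nat_ball[of ?M B undefined] emeasure_SUP_nat_ball[of ?N B undefined] B
      by (simp add: D_def)
    finally show "emeasure (borel_extension (patch P \<mu> \<nu>)) B = emeasure ?M B + emeasure ?N B" .
  qed (use f in auto)
  also have "(\<integral>\<^sup>+x. f x \<partial>?M) = (\<integral>\<^sup>+x. f x * indicator P x \<partial>borel_extension \<mu>)"
    using f P by (subst nn_integral_density) (auto simp: mult.commute)
  also have "(\<integral>\<^sup>+x. f x \<partial>?N) = (\<integral>\<^sup>+x. f x * indicator (- P) x \<partial>borel_extension \<nu>)"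
    using f P' by (subst nn_integral_density) (auto simp: mult.commute)
  finally show ?thesis .
qed

section \<open>Integrals of test functions and the mass inequality\<close>

lemma nn_integral_Lip_bs_le:
  assumes \<mu>: "\<mu> \<in> M0b_nonneg" and f: "f \<in> Lip_bs" and M: "\<And>x. \<bar>f x\<bar> \<le> M"
  shows "(\<integral>\<^sup>+x. ennreal \<bar>f x\<bar> \<partial>borel_extension \<mu>) \<le> ennreal M * ennreal (\<mu> (supp f))"
proof -
  have sf: "supp f \<in> bounded_borel" by (rule supp_bounded_borel[OF f])
  have "(\<integral>\<^sup>+x. ennreal \<bar>f x\<bar> \<partial>borel_extension \<mu>) \<le>
      (\<integral>\<^sup>+x. ennreal M * indicator (supp f) x \<partial>borel_extension \<mu>)"
    using M by (intro nn_integral_mono) (auto simp: indicator_def supp_zero intro!: ennreal_leI)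
  also have "\<dots> = ennreal M * ennreal (\<mu> (supp f))"
    using sf by (subst nn_integral_cmult_indicator)
      (auto simp: emeasure_borel_extension[OF \<mu>] bounded_borel_sets)
  finally show ?thesis .
qed

lemma nn_integral_Lip_bs_finite:
  assumes \<mu>: "\<mu> \<in> M0b_nonneg" and f: "f \<in> Lip_bs"
  shows "(\<integral>\<^sup>+x. ennreal \<bar>f x\<bar> \<partial>borel_extension \<mu>) < top"
proof -
  obtain M where "\<And>x. \<bar>f x\<bar> \<le> M"
    using Lip_bs_bounded[OF f] by blast
  from nn_integral_Lip_bs_le[OF \<mu> f this] show ?thesis
    by (rule le_less_trans) (simp add: ennreal_mult_less_top)
qed

lemma nn_integral_Lip_bs:
  assumes \<mu>: "\<mu> \<in> M0b_nonneg" and f: "f \<in> Lip_bs"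
  shows "(\<integral>\<^sup>+x. ennreal \<bar>f x\<bar> \<partial>borel_extension \<mu>) = ennreal (\<integral>x. \<bar>f x\<bar> \<partial>borel_extension \<mu>)"
proof (rule nn_integral_eq_integral)
  show "integrable (borel_extension \<mu>) (\<lambda>x. \<bar>f x\<bar>)"
    using nn_integral_Lip_bs_finite[OF \<mu> f] Lip_bs_borel_measurable[OF f]
    by (intro integrableI_bounded) auto
qed auto

text \<open>The mass inequality in \<open>ennreal\<close>, where additivity in the measure needs no
  integrability side conditions. Both forms agree because a Lipschitz function with bounded support
  is integrable for a locally finite measure.\<close>

lemma mass_bounds_iff:
  "\<mu> \<in> mass_bounds m T \<longleftrightarrow> \<mu> \<in> M0b_nonneg \<and> (\<forall>f\<in>Lip_bs. \<forall>\<pi>\<in>Lip_tuples m.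
    ennreal \<bar>T f \<pi>\<bar> \<le> ennreal (\<Prod>i<m. lip_const (\<pi> ! i)) * (\<integral>\<^sup>+x. ennreal \<bar>f x\<bar> \<partial>borel_extension \<mu>))"
proof -
  have "\<bar>T f \<pi>\<bar> \<le> (\<Prod>i<m. lip_const (\<pi> ! i)) * (\<integral>x. \<bar>f x\<bar> \<partial>borel_extension \<mu>) \<longleftrightarrow>
      ennreal \<bar>T f \<pi>\<bar> \<le> ennreal (\<Prod>i<m. lip_const (\<pi> ! i)) * (\<integral>\<^sup>+x. ennreal \<bar>f x\<bar> \<partial>borel_extension \<mu>)"
    if "\<mu> \<in> M0b_nonneg" "f \<in> Lip_bs" "\<pi> \<in> Lip_tuples m" for f \<pi>
    using that prod_lip_const_nonneg[of \<pi> m]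
    by (simp add: nn_integral_Lip_bs ennreal_mult[symmetric] integral_nonneg_AE)
  then show ?thesis unfolding mass_bounds_def by auto
qed

lemma mass_bounds_M0b_nonneg: "\<mu> \<in> mass_bounds m T \<Longrightarrow> \<mu> \<in> M0b_nonneg"
  by (simp add: mass_bounds_iff)

lemma mass_boundsD:
  assumes "\<mu> \<in> mass_bounds m T" "f \<in> Lip_bs" "\<pi> \<in> Lip_tuples m"
  shows "ennreal \<bar>T f \<pi>\<bar> \<le>
    ennreal (\<Prod>i<m. lip_const (\<pi> ! i)) * (\<integral>\<^sup>+x. ennreal \<bar>f x\<bar> \<partial>borel_extension \<mu>)"
  using assms by (simp add: mass_bounds_iff)

section \<open>Existence of the mass\<close>

lemma Lip_add: "f \<in> Lip \<Longrightarrow> g \<in> Lip \<Longrightarrow> (\<lambda>x. f x + g x) \<in> Lip"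
  unfolding Lip_def by (blast intro: lipschitz_on_add)

lemma Lip_const: "(\<lambda>x. c) \<in> Lip"
  by (rule LipI[of 0]) (auto simp: lipschitz_on_def)

lemma Lip_one_minus:
  assumes "f \<in> Lip"
  shows "(\<lambda>x. 1 - f x) \<in> Lip"
proof -
  obtain L where L: "L-lipschitz_on UNIV f" using assms by (auto simp: Lip_def)
  have "L-lipschitz_on UNIV (\<lambda>x. 1 - f x)"
    using lipschitz_on_nonneg[OF L] lipschitz_onD[OF L]
    by (intro lipschitz_onI) (auto simp: dist_real_def abs_minus_commute)
  then show ?thesis by (rule LipI)
qed

lemma Lip_min_one:
  assumes "f \<in> Lip"
  shows "(\<lambda>x. min 1 (f x)) \<in> Lip"
proof -
  obtain L where L: "L-lipschitz_on UNIV f" using assms by (auto simp: Lip_def)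
  have "L-lipschitz_on UNIV (\<lambda>x. min 1 (f x))"
  proof (rule lipschitz_onI)
    fix x y
    have "dist (min 1 (f x)) (min 1 (f y)) \<le> dist (f x) (f y)"
      by (auto simp: dist_real_def)
    also have "\<dots> \<le> L * dist x y"
      using lipschitz_onD[OF L] by simp
    finally show "dist (min 1 (f x)) (min 1 (f y)) \<le> L * dist x y" .
  qed (rule lipschitz_on_nonneg[OF L])
  then show ?thesis by (rule LipI)
qed

lemma Lip_sum: "(\<And>i. i < n \<Longrightarrow> f i \<in> Lip) \<Longrightarrow> (\<lambda>x. \<Sum>i<n. f i x) \<in> Lip" for n :: nat
  by (induction n) (auto intro: Lip_add Lip_const)

text \<open>For nonempty closed \<open>A\<close> these cut-offs decrease to the indicator of
  \<open>A\<close> as \<open>k\<close> grows: they are \<open>1\<close> on \<open>A\<close> and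
  vanish at distance \<open>1 / k\<close> or more.\<close>

lemma Lip_infdist_cutoff: "(\<lambda>x. max 0 (1 - real k * infdist x A)) \<in> Lip"
proof (rule LipI[OF lipschitz_onI])
  fix x y :: 'a
  have "\<bar>infdist x A - infdist y A\<bar> \<le> dist x y"
    using infdist_triangle[of x A y] infdist_triangle[of y A x] by (auto simp: dist_commute)
  then have "\<bar>real k * infdist x A - real k * infdist y A\<bar> \<le> real k * dist x y"
    by (metis abs_mult abs_of_nat mult_left_mono of_nat_0_le_iff right_diff_distrib)
  then show "dist (max 0 (1 - real k * infdist x A)) (max 0 (1 - real k * infdist y A)) \<le> real k * dist x y"
    by (auto simp: dist_real_def max_def)
qed simp

text \<open>Dynkin induction from the closed sets, which generate the Borel sets and are stable
  under intersection. Closed sets use distance cut-offs and dominated convergence, complements use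
  \<open>1 - \<phi>\<close>, disjoint unions a truncated finite sum. The tolerance stays arbitrary
  because the union step calls the hypothesis with a smaller one.\<close>

lemma Lip_approx_indicator:
  fixes M :: "'a::metric_space measure"
  assumes fin: "finite_measure M" and sets: "sets M = sets borel" and P: "P \<in> sets borel"
    and e: "0 < e"
  shows "\<exists>\<phi>\<in>Lip. (\<forall>x. 0 \<le> \<phi> x \<and> \<phi> x \<le> 1) \<and> (\<integral>x. \<bar>\<phi> x - indicator P x\<bar> \<partial>M) < e"
proof -
  interpret finite_measure M by (rule fin)
  have sp: "space M = UNIV" using sets_eq_imp_space_eq[OF sets] by simp
  note [measurable_cong] = sets
  have int: "integrable M (\<lambda>x. \<bar>\<phi> x - indicator A x\<bar>)"
    if "\<phi> \<in> Lip" "\<forall>x. 0 \<le> \<phi> x \<and> \<phi> x \<le> 1" "A \<in> sets borel" for \<phi> :: "'a \<Rightarrow> real" and A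
  proof (rule integrable_const_bound[of _ 1])
    have "\<bar>\<phi> x - indicator A x\<bar> \<le> 1" for x
      using that(2)[rule_format, of x] by (auto simp: indicator_def)
    then show "AE x in M. norm \<bar>\<phi> x - indicator A x\<bar> \<le> 1" by simp
    show "(\<lambda>x. \<bar>\<phi> x - indicator A x\<bar>) \<in> borel_measurable M"
      using Lip_borel_measurable[OF that(1)] that(3) by measurable
  qed
  have gen: "sets borel = sigma_sets UNIV (Collect closed :: 'a set set)"
    by (subst borel_eq_closed) (simp add: sets_measure_of)
  have "Int_stable (Collect closed :: 'a set set)"
    by (auto simp: Int_stable_def)
  moreover have "Collect closed \<subseteq> Pow (UNIV :: 'a set)" by simp
  moreover have "P \<in> sigma_sets UNIV (Collect closed)" using P gen by simp
  ultimately show ?thesis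
    using e
  proof (induction arbitrary: e rule: sigma_sets_induct_disjoint)
    case (basic A)
    then have A: "closed A" by simp
    show ?case
    \<comment> \<open>The distance to the empty set is \<open>0\<close> by convention, so there the
      cut-offs would be constantly \<open>1\<close> instead of approximating
      \<open>0\<close>.\<close>
    proof (cases "A = {}")
      case True
      then show ?thesis using basic by (intro bexI[of _ "\<lambda>x. 0"]) (auto simp: Lip_const)
    next
      case False
      define \<phi> where "\<phi> k x = max 0 (1 - real k * infdist x A)" for k x
      have \<phi>: "\<phi> k \<in> Lip" for k unfolding \<phi>_def by (rule Lip_infdist_cutoff)
      have b: "\<forall>x. 0 \<le> \<phi> k x \<and> \<phi> k x \<le> 1" for k
        by (auto simp: \<phi>_def infdist_nonneg)
      have lim: "(\<lambda>k. \<bar>\<phi> k x - indicator A x\<bar>) \<longlonglongrightarrow> 0" for x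
      proof (cases "x \<in> A")
        case True
        then show ?thesis by (simp add: \<phi>_def)
      next
        case x: False
        then have d: "0 < infdist x A"
          using infdist_pos_not_in_closed[OF A False] by simp
        have "\<forall>\<^sub>F k in sequentially. \<bar>\<phi> k x - indicator A x\<bar> = 0"
        proof -
          obtain N :: nat where N: "1 / infdist x A < real N" using reals_Archimedean2 by blast
          have "\<bar>\<phi> k x - indicator A x\<bar> = 0" if "N \<le> k" for k
          proof -
            have "1 \<le> real N * infdist x A" using N d by (simp add: field_simps)
            also have "\<dots> \<le> real k * infdist x A" using that d by (intro mult_right_mono) auto
            finally show ?thesis using x by (simp add: \<phi>_def)
          qed
          then show ?thesis by (auto simp: eventually_sequentially)
        qed
        then show ?thesis by (rule tendsto_eventually)
      qed
      have "(\<lambda>k. \<integral>x. \<bar>\<phi> k x - indicator A x\<bar> \<partial>M) \<longlonglongrightarrow> (\<integral>x. 0 \<partial>M)"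
      proof (rule integral_dominated_convergence[where w = "\<lambda>x. 1"])
        show "(\<lambda>x. \<bar>\<phi> k x - indicator A x\<bar>) \<in> borel_measurable M" for k
          by (rule borel_measurable_integrable[OF int[OF \<phi> b borel_closed[OF A]]])
        have "\<bar>\<phi> k x - indicator A x\<bar> \<le> 1" for k x
          using b[of k, rule_format, of x] by (auto simp: indicator_def)
        then show "AE x in M. norm \<bar>\<phi> k x - indicator A x\<bar> \<le> 1" for k by simp
      qed (use lim in auto)
      then have "\<forall>\<^sub>F k in sequentially. (\<integral>x. \<bar>\<phi> k x - indicator A x\<bar> \<partial>M) < e"
        using basic by (intro order_tendstoD(2)[of _ 0]) auto
      then obtain k where "(\<integral>x. \<bar>\<phi> k x - indicator A x\<bar> \<partial>M) < e"
        by (auto simp: eventually_sequentially)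
      then show ?thesis using \<phi>[of k] b[of k] by (intro bexI[of _ "\<phi> k"]) auto
    qed
  next
    case empty
    then show ?case by (intro bexI[of _ "\<lambda>x. 0"]) (auto simp: Lip_const)
  next
    case (compl A)
    then obtain \<phi> where \<phi>: "\<phi> \<in> Lip" "\<forall>x. 0 \<le> \<phi> x \<and> \<phi> x \<le> 1"
        "(\<integral>x. \<bar>\<phi> x - indicator A x\<bar> \<partial>M) < e"
      by blast
    have "\<bar>1 - \<phi> x - indicator (UNIV - A) x\<bar> = \<bar>\<phi> x - indicator A x\<bar>" for x
      by (auto simp: indicator_def)
    then show ?case
      using \<phi> by (intro bexI[of _ "\<lambda>x. 1 - \<phi> x"]) (auto intro: Lip_one_minus)
  next
    case (union A)
    have sA: "A i \<in> sets borel" for i using union.hyps gen by auto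
    have "(\<lambda>i. measure M (A i)) sums measure M (\<Union>i. A i)"
      using union.hyps sA by (intro finite_measure_UNION) (auto simp: sets)
    then have "(\<lambda>n. \<Sum>i<n. measure M (A i)) \<longlonglongrightarrow> measure M (\<Union>i. A i)"
      by (simp add: sums_def)
    then have "\<forall>\<^sub>F n in sequentially. measure M (\<Union>i. A i) - e / 2 < (\<Sum>i<n. measure M (A i))"
      using union.prems by (intro order_tendstoD(1)) auto
    \<comment> \<open>Half of the tolerance pays for the members of the union from index
      \<open>n\<close> on, whose total measure is below \<open>e / 2\<close>.\<close>
    then obtain n where n: "measure M (\<Union>i. A i) - e / 2 < (\<Sum>i<n. measure M (A i))"
      by (auto simp: eventually_sequentially)
    \<comment> \<open>The \<open>n\<close> individual errors add up to at most the other half of the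
      tolerance; the \<open>+ 1\<close> keeps the denominator positive for
      \<open>n = 0\<close>.\<close>
    define d where "d = e / (2 * (real n + 1))"
    have d: "0 < d" using union.prems by (simp add: d_def)
    have "\<forall>i. \<exists>\<phi>. \<phi> \<in> Lip \<and> (\<forall>x. 0 \<le> \<phi> x \<and> \<phi> x \<le> 1) \<and> (\<integral>x. \<bar>\<phi> x - indicator (A i) x\<bar> \<partial>M) < d"
      using union.IH[OF d] by blast
    from choice[OF this] obtain \<phi> where
      "\<forall>i. \<phi> i \<in> Lip \<and> (\<forall>x. 0 \<le> \<phi> i x \<and> \<phi> i x \<le> 1) \<and> (\<integral>x. \<bar>\<phi> i x - indicator (A i) x\<bar> \<partial>M) < d" ..
    then have \<phi>: "\<phi> i \<in> Lip" "\<forall>x. 0 \<le> \<phi> i x \<and> \<phi> i x \<le> 1"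
      "(\<integral>x. \<bar>\<phi> i x - indicator (A i) x\<bar> \<partial>M) < d" for i by auto
    \<comment> \<open>Truncation restores values in \<open>[0,1]\<close>. It does not increase the
      distance to an indicator, whose values are at most \<open>1\<close>.\<close>
    define \<psi> where "\<psi> x = min 1 (\<Sum>i<n. \<phi> i x)" for x
    define R where "R = (\<Union>i. A i) - (\<Union>i<n. A i)"
    have \<psi>: "\<psi> \<in> Lip" unfolding \<psi>_def by (intro Lip_min_one Lip_sum \<phi>)
    have \<psi>b: "\<forall>x. 0 \<le> \<psi> x \<and> \<psi> x \<le> 1"
      using \<phi>(2) by (auto simp: \<psi>_def intro!: sum_nonneg)
    have sR: "R \<in> sets M" using sA by (auto simp: R_def sets)
    have ind: "indicator (\<Union>i<n. A i) x = (\<Sum>i<n. indicator (A i) x :: real)" for x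
      by (rule indicator_UN_disjoint) (use union.hyps in \<open>auto simp: disjoint_family_on_def\<close>)
    have "\<bar>\<psi> x - indicator (\<Union>i. A i) x\<bar> \<le> (\<Sum>i<n. \<bar>\<phi> i x - indicator (A i) x\<bar>) + indicator R x" for x
    proof -
      have "indicator (\<Union>i. A i) x = (indicator (\<Union>i<n. A i) x + indicator R x :: real)"
        by (auto simp: R_def indicator_def)
      moreover have "\<bar>\<psi> x - indicator (\<Union>i<n. A i) x\<bar> \<le> \<bar>(\<Sum>i<n. \<phi> i x) - indicator (\<Union>i<n. A i) x\<bar>"
        by (auto simp: \<psi>_def indicator_def)
      moreover have "\<bar>(\<Sum>i<n. \<phi> i x) - indicator (\<Union>i<n. A i) x\<bar> \<le> (\<Sum>i<n. \<bar>\<phi> i x - indicator (A i) x\<bar>)"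
        unfolding ind sum_subtractf[symmetric] by (rule sum_abs)
      moreover have "(0::real) \<le> indicator R x" by simp
      ultimately show ?thesis by linarith
    qed
    then have "(\<integral>x. \<bar>\<psi> x - indicator (\<Union>i. A i) x\<bar> \<partial>M) \<le>
        (\<integral>x. (\<Sum>i<n. \<bar>\<phi> i x - indicator (A i) x\<bar>) + indicator R x \<partial>M)"
      using int[OF \<psi> \<psi>b] int[OF \<phi>(1,2)] sA sR
      by (intro integral_mono) (auto intro!: integrable_real_indicator simp: emeasure_eq_measure)
    also have "\<dots> = (\<Sum>i<n. \<integral>x. \<bar>\<phi> i x - indicator (A i) x\<bar> \<partial>M) + measure M R"
      using int[OF \<phi>(1,2)] sA sR
      by (subst Bochner_Integration.integral_add)
        (auto intro!: integrable_real_indicator simp: emeasure_eq_measure sp)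
    also have "measure M R < e / 2"
    proof -
      have "measure M (\<Union>i<n. A i) = (\<Sum>i<n. measure M (A i))"
        using sA union.hyps(1)
        by (intro finite_measure_finite_Union) (auto simp: disjoint_family_on_def sets)
      moreover have "measure M R = measure M (\<Union>i. A i) - measure M (\<Union>i<n. A i)"
        unfolding R_def using sA by (intro finite_measure_Diff) (auto simp: sets)
      ultimately show ?thesis using n by simp
    qed
    also have "(\<Sum>i<n. \<integral>x. \<bar>\<phi> i x - indicator (A i) x\<bar> \<partial>M) \<le> (\<Sum>i<n. d)"
      using \<phi>(3) by (intro sum_mono) (auto intro: less_imp_le)
    also have "(\<Sum>i<n. d) \<le> e / 2"
      using union.prems by (simp add: d_def field_simps)
    finally have "(\<integral>x. \<bar>\<psi> x - indicator (\<Union>i. A i) x\<bar> \<partial>M) < e" by simp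
    then show ?case using \<psi> \<psi>b by blast
  qed
qed

text \<open>Splitting \<open>f = f \<phi> + f (1 - \<phi>)\<close> with a Lipschitz \<open>\<phi>\<close> close to the indicator of \<open>P\<close> allows
  one to use a different mass bound on \<open>P\<close> and on its complement.\<close>

lemma mass_bounds_patch:
  assumes T: "multilinear_functional m T"
    and \<mu>: "\<mu> \<in> mass_bounds m T" and \<nu>: "\<nu> \<in> mass_bounds m T" and P: "P \<in> sets borel"
  shows "patch P \<mu> \<nu> \<in> mass_bounds m T"
  unfolding mass_bounds_iff
proof (intro conjI ballI)
  have \<mu>0: "\<mu> \<in> M0b_nonneg" and \<nu>0: "\<nu> \<in> M0b_nonneg"
    using \<mu> \<nu> by (auto intro: mass_bounds_M0b_nonneg)
  then show "patch P \<mu> \<nu> \<in> M0b_nonneg" using P by (rule M0b_nonneg_patch)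
  fix f :: "'a \<Rightarrow> real" and \<pi> :: "('a \<Rightarrow> real) list"
  assume f: "f \<in> Lip_bs" and \<pi>: "\<pi> \<in> Lip_tuples m"
  define c where "c = (\<Prod>i<m. lip_const (\<pi> ! i))"
  have c: "0 \<le> c" unfolding c_def by (rule prod_lip_const_nonneg[OF \<pi>])
  have fm[measurable]: "f \<in> borel_measurable borel" by (rule Lip_bs_borel_measurable[OF f])
  note P[measurable]
  have sf[measurable]: "supp f \<in> sets borel" by (rule bounded_borel_sets[OF supp_bounded_borel[OF f]])
  obtain b where b: "0 \<le> b" "\<And>x. \<bar>f x\<bar> \<le> b" using Lip_bs_bounded[OF f] by blast
  let ?L = "borel_extension (\<lambda>B. \<mu> B + \<nu> B)"
  let ?I = "(\<integral>\<^sup>+x. ennreal \<bar>f x\<bar> * indicator P x \<partial>borel_extension \<mu>) +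
    (\<integral>\<^sup>+x. ennreal \<bar>f x\<bar> * indicator (- P) x \<partial>borel_extension \<nu>)"
  have "ennreal \<bar>T f \<pi>\<bar> \<le> ennreal c * ?I"
  proof (rule ennreal_le_epsilon)
    fix e :: real assume e: "0 < e"
    \<comment> \<open>The total error will be \<open>c * b * d\<close>, which is at most
      \<open>e\<close>; the \<open>+ 1\<close> covers \<open>c * b = 0\<close>.\<close>
    define d where "d = e / (c * b + 1)"
    have cb: "0 \<le> c * b" using c b by simp
    have d: "0 < d" using e cb by (simp add: d_def add_nonneg_pos)
    \<comment> \<open>The approximation needs a finite measure, hence the restriction to the bounded
      support. Using the sum of both measures makes one \<open>\<phi>\<close> good for
      \<open>\<mu>\<close> and \<open>\<nu>\<close> simultaneously.\<close>
    define M where "M = density ?L (indicator (supp f))"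
    have "emeasure M UNIV = ennreal (\<mu> (supp f) + \<nu> (supp f))"
      unfolding M_def
      by (subst emeasure_restricted)
        (auto simp: emeasure_borel_extension[OF M0b_nonneg_plus[OF \<mu>0 \<nu>0]] supp_bounded_borel[OF f])
    then have "finite_measure M"
      by (intro finite_measureI) (simp add: M_def)
    moreover have sM: "sets M = sets borel" by (simp add: M_def)
    ultimately obtain \<phi> where \<phi>: "\<phi> \<in> Lip" "\<And>x. 0 \<le> \<phi> x" "\<And>x. \<phi> x \<le> 1"
        and small: "(\<integral>x. \<bar>\<phi> x - indicator P x\<bar> \<partial>M) < d"
      using Lip_approx_indicator[OF _ _ P d] by blast
    have \<phi>m[measurable]: "\<phi> \<in> borel_measurable borel" by (rule Lip_borel_measurable[OF \<phi>(1)])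
    \<comment> \<open>The pointwise error of replacing the indicator of \<open>P\<close> by
      \<open>\<phi>\<close>, cut down to where \<open>f\<close> lives. The complement has the same
      error with \<open>1 - \<phi>\<close>.\<close>
    define h where "h x = ennreal \<bar>\<phi> x - indicator P x\<bar> * indicator (supp f) x" for x
    have hm[measurable]: "h \<in> borel_measurable borel" unfolding h_def by measurable
    have h: "(\<integral>\<^sup>+x. h x \<partial>?L) \<le> ennreal d"
    proof -
      interpret finite_measure M by fact
      have "(\<integral>\<^sup>+x. h x \<partial>?L) = (\<integral>\<^sup>+x. ennreal \<bar>\<phi> x - indicator P x\<bar> \<partial>M)"
        unfolding M_def h_def by (subst nn_integral_density) (auto simp: mult.commute)
      also have "\<dots> = ennreal (\<integral>x. \<bar>\<phi> x - indicator P x\<bar> \<partial>M)"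
      proof (rule nn_integral_eq_integral[OF integrable_const_bound[of _ 1]])
        have "\<bar>\<phi> x - indicator P x\<bar> \<le> 1" for x
          using \<phi>(2,3)[of x] by (auto simp: indicator_def)
        then show "AE x in M. norm \<bar>\<phi> x - indicator P x\<bar> \<le> 1" by simp
        show "(\<lambda>x. \<bar>\<phi> x - indicator P x\<bar>) \<in> borel_measurable M"
          unfolding M_def by measurable
      qed auto
      finally show ?thesis using small by (simp add: ennreal_leI)
    qed
    have 1: "(\<lambda>x. f x * \<phi> x) \<in> Lip_bs" by (rule Lip_bs_mult[OF f \<phi>])
    have 2: "(\<lambda>x. f x * (1 - \<phi> x)) \<in> Lip_bs"
      using \<phi> by (intro Lip_bs_mult[OF f] Lip_one_minus) auto
    have B1: "(\<integral>\<^sup>+x. ennreal \<bar>f x * \<phi> x\<bar> \<partial>borel_extension \<mu>) \<le>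
        (\<integral>\<^sup>+x. ennreal \<bar>f x\<bar> * indicator P x + ennreal b * h x \<partial>borel_extension \<mu>)"
    proof (rule nn_integral_mono)
      fix x
      have "\<bar>f x * \<phi> x\<bar> \<le> \<bar>f x\<bar> * indicator P x + b * (\<bar>\<phi> x - indicator P x\<bar> * indicator (supp f) x)"
      proof (cases "x \<in> supp f")
        case True
        have "\<bar>f x * \<phi> x\<bar> = \<bar>f x\<bar> * \<phi> x" using \<phi> by (simp add: abs_mult)
        also have "\<dots> \<le> \<bar>f x\<bar> * (indicator P x + \<bar>\<phi> x - indicator P x\<bar>)"
          by (intro mult_left_mono) auto
        also have "\<dots> \<le> \<bar>f x\<bar> * indicator P x + b * \<bar>\<phi> x - indicator P x\<bar>"
          unfolding distrib_left using b by (intro add_mono mult_right_mono) auto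
        finally show ?thesis using True by simp
      qed (simp add: supp_zero)
      then have "ennreal \<bar>f x * \<phi> x\<bar> \<le>
          ennreal (\<bar>f x\<bar> * indicator P x + b * (\<bar>\<phi> x - indicator P x\<bar> * indicator (supp f) x))"
        by (rule ennreal_leI)
      also have "\<dots> = ennreal \<bar>f x\<bar> * indicator P x + ennreal b * h x"
        using b by (subst ennreal_plus) (auto simp: h_def ennreal_mult ennreal_indicator)
      finally show "ennreal \<bar>f x * \<phi> x\<bar> \<le> ennreal \<bar>f x\<bar> * indicator P x + ennreal b * h x" .
    qed
    have B2: "(\<integral>\<^sup>+x. ennreal \<bar>f x * (1 - \<phi> x)\<bar> \<partial>borel_extension \<nu>) \<le>
        (\<integral>\<^sup>+x. ennreal \<bar>f x\<bar> * indicator (- P) x + ennreal b * h x \<partial>borel_extension \<nu>)"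
    proof (rule nn_integral_mono)
      fix x
      have "\<bar>f x * (1 - \<phi> x)\<bar> \<le>
          \<bar>f x\<bar> * indicator (- P) x + b * (\<bar>\<phi> x - indicator P x\<bar> * indicator (supp f) x)"
      proof (cases "x \<in> supp f")
        case True
        have "\<bar>f x * (1 - \<phi> x)\<bar> = \<bar>f x\<bar> * (1 - \<phi> x)" using \<phi> by (simp add: abs_mult)
        also have "\<dots> \<le> \<bar>f x\<bar> * (indicator (- P) x + \<bar>\<phi> x - indicator P x\<bar>)"
          by (intro mult_left_mono) (auto simp: indicator_def)
        also have "\<dots> \<le> \<bar>f x\<bar> * indicator (- P) x + b * \<bar>\<phi> x - indicator P x\<bar>"
          unfolding distrib_left using b by (intro add_mono mult_right_mono) auto
        finally show ?thesis using True by simp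
      qed (simp add: supp_zero)
      then have "ennreal \<bar>f x * (1 - \<phi> x)\<bar> \<le>
          ennreal (\<bar>f x\<bar> * indicator (- P) x + b * (\<bar>\<phi> x - indicator P x\<bar> * indicator (supp f) x))"
        by (rule ennreal_leI)
      also have "\<dots> = ennreal \<bar>f x\<bar> * indicator (- P) x + ennreal b * h x"
        using b by (subst ennreal_plus) (auto simp: h_def ennreal_mult ennreal_indicator)
      finally show "ennreal \<bar>f x * (1 - \<phi> x)\<bar> \<le> ennreal \<bar>f x\<bar> * indicator (- P) x + ennreal b * h x" .
    qed
    have "T (\<lambda>x. 1 * (f x * \<phi> x) + 1 * (f x * (1 - \<phi> x))) \<pi> =
        1 * T (\<lambda>x. f x * \<phi> x) \<pi> + 1 * T (\<lambda>x. f x * (1 - \<phi> x)) \<pi>"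
      by (rule T[unfolded multilinear_functional_def, THEN conjunct1, rule_format, OF 1 2 \<pi>])
    moreover have "(\<lambda>x. 1 * (f x * \<phi> x) + 1 * (f x * (1 - \<phi> x))) = f"
      by (auto simp: algebra_simps)
    ultimately have "\<bar>T f \<pi>\<bar> \<le> \<bar>T (\<lambda>x. f x * \<phi> x) \<pi>\<bar> + \<bar>T (\<lambda>x. f x * (1 - \<phi> x)) \<pi>\<bar>"
      by simp
    then have "ennreal \<bar>T f \<pi>\<bar> \<le>
        ennreal (\<bar>T (\<lambda>x. f x * \<phi> x) \<pi>\<bar> + \<bar>T (\<lambda>x. f x * (1 - \<phi> x)) \<pi>\<bar>)"
      by (rule ennreal_leI)
    also have "\<dots> = ennreal \<bar>T (\<lambda>x. f x * \<phi> x) \<pi>\<bar> + ennreal \<bar>T (\<lambda>x. f x * (1 - \<phi> x)) \<pi>\<bar>"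
      by simp
    also have "\<dots> \<le> ennreal c * (\<integral>\<^sup>+x. ennreal \<bar>f x * \<phi> x\<bar> \<partial>borel_extension \<mu>) +
        ennreal c * (\<integral>\<^sup>+x. ennreal \<bar>f x * (1 - \<phi> x)\<bar> \<partial>borel_extension \<nu>)"
      unfolding c_def by (intro add_mono mass_boundsD[OF \<mu> 1 \<pi>] mass_boundsD[OF \<nu> 2 \<pi>])
    also have "\<dots> \<le>
        ennreal c * (\<integral>\<^sup>+x. ennreal \<bar>f x\<bar> * indicator P x + ennreal b * h x \<partial>borel_extension \<mu>) +
        ennreal c * (\<integral>\<^sup>+x. ennreal \<bar>f x\<bar> * indicator (- P) x + ennreal b * h x \<partial>borel_extension \<nu>)"
      by (intro add_mono mult_left_mono B1 B2) auto
    \<comment> \<open>The two error integrals, against \<open>\<mu>\<close> and against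
      \<open>\<nu>\<close>, combine into one against the sum, which is the quantity that
      \<open>\<phi>\<close> makes small.\<close>
    also have "\<dots> =
        ennreal c * ?I + ennreal c * (ennreal b * (\<integral>\<^sup>+x. h x \<partial>?L))"
      by (simp add: nn_integral_add nn_integral_cmult nn_integral_borel_extension_plus[OF \<mu>0 \<nu>0 hm]
          distrib_left ac_simps)
    also have "\<dots> \<le> ennreal c * ?I + ennreal c * (ennreal b * ennreal d)"
      by (intro add_left_mono mult_left_mono h) auto
    also have "\<dots> \<le> ennreal c * ?I + ennreal e"
    proof -
      have "c * (b * d) \<le> e"
        using e cb by (simp add: d_def field_simps add_nonneg_pos)
      then show ?thesis
        using c b d by (intro add_left_mono) (simp add: ennreal_mult[symmetric] ennreal_leI)
    qed
    finally show "ennreal \<bar>T f \<pi>\<bar> \<le> ennreal c * ?I + ennreal e" .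
  qed
  then show "ennreal \<bar>T f \<pi>\<bar> \<le> ennreal (\<Prod>i<m. lip_const (\<pi> ! i)) *
      (\<integral>\<^sup>+x. ennreal \<bar>f x\<bar> \<partial>borel_extension (patch P \<mu> \<nu>))"
    by (simp add: c_def nn_integral_borel_extension_patch[OF \<mu>0 \<nu>0 P])
qed

section \<open>The infimum of the mass bounds\<close>

text \<open>Later estimates use this real-valued set function in place of the measure
  \<open>mass m T\<close>, because on bounded sets its values can be subtracted. A priori it is
  neither additive nor a bound.\<close>

definition least_bound :: "nat \<Rightarrow> 'a::metric_space functional \<Rightarrow> 'a set \<Rightarrow> real" where
  "least_bound m T B = (INF \<mu>\<in>mass_bounds m T. \<mu> B)"

lemma least_bound_le:
  assumes "\<mu> \<in> mass_bounds m T"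
  shows "least_bound m T B \<le> \<mu> B"
  unfolding least_bound_def
  using assms by (intro cINF_lower bdd_belowI2[of _ 0])
    (auto intro: M0b_nonneg_nonneg dest: mass_bounds_M0b_nonneg)

lemma least_bound_approx:
  assumes "mass_bounds m T \<noteq> {}" "0 < e"
  obtains \<mu> where "\<mu> \<in> mass_bounds m T" "\<mu> B < least_bound m T B + e"
proof -
  have "bdd_below ((\<lambda>\<mu>. \<mu> B) ` mass_bounds m T)"
    by (intro bdd_belowI2[of _ 0]) (auto intro: M0b_nonneg_nonneg dest: mass_bounds_M0b_nonneg)
  then show thesis
    using assms that cINF_less_iff[of "mass_bounds m T" "\<lambda>\<mu>. \<mu> B" "least_bound m T B + e"]
    unfolding least_bound_def by auto
qed

lemma least_bound_nonneg:
  assumes "mass_bounds m T \<noteq> {}"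
  shows "0 \<le> least_bound m T B"
  unfolding least_bound_def
  using assms by (intro cINF_greatest) (auto intro: M0b_nonneg_nonneg dest: mass_bounds_M0b_nonneg)

text \<open>Only additivity needs patching: superadditivity is inherited from each bound, and
  subadditivity needs one bound nearly optimal on \<open>A\<close> and on \<open>B\<close>.
  Continuity at the empty set, concentration and the default value follow from domination by the
  single bound \<open>\<mu>0\<close>.\<close>

lemma least_bound_M0b_nonneg:
  assumes T: "multilinear_functional m T" and ne: "mass_bounds m T \<noteq> {}"
  shows "least_bound m T \<in> M0b_nonneg"
proof -
  obtain \<mu>0 where \<mu>0: "\<mu>0 \<in> mass_bounds m T" using ne by blast
  note \<mu>0' = mass_bounds_M0b_nonneg[OF \<mu>0]
  have squeeze: "least_bound m T B = 0" if "\<mu>0 B = 0" for B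
    using least_bound_le[OF \<mu>0, of B] least_bound_nonneg[OF ne, of B] that by simp
  show ?thesis
  proof (rule M0b_nonnegI)
    fix A B :: "'a set"
    assume A: "A \<in> bounded_borel" and B: "B \<in> bounded_borel" and AB: "A \<inter> B = {}"
    show "least_bound m T (A \<union> B) = least_bound m T A + least_bound m T B"
    proof (rule antisym)
      show "least_bound m T (A \<union> B) \<le> least_bound m T A + least_bound m T B"
      proof (rule field_le_epsilon)
        fix e :: real assume e: "0 < e"
        obtain \<mu> where \<mu>: "\<mu> \<in> mass_bounds m T" "\<mu> A < least_bound m T A + e / 2"
          using least_bound_approx[OF ne, of "e / 2"] e by auto
        obtain \<nu> where \<nu>: "\<nu> \<in> mass_bounds m T" "\<nu> B < least_bound m T B + e / 2"
          using least_bound_approx[OF ne, of "e / 2"] e by auto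
        have "patch A \<mu> \<nu> \<in> mass_bounds m T"
          by (intro mass_bounds_patch[OF T \<mu>(1) \<nu>(1)] bounded_borel_sets A)
        then have "least_bound m T (A \<union> B) \<le> patch A \<mu> \<nu> (A \<union> B)" by (rule least_bound_le)
        also have "\<dots> = \<mu> A + \<nu> B"
        proof -
          have "(A \<union> B) \<inter> A = A" "(A \<union> B) - A = B" using AB by auto
          then show ?thesis using A B by (simp add: patch_def bounded_borel_Un)
        qed
        finally show "least_bound m T (A \<union> B) \<le> least_bound m T A + least_bound m T B + e"
          using \<mu> \<nu> by simp
      qed
      show "least_bound m T A + least_bound m T B \<le> least_bound m T (A \<union> B)"
        unfolding least_bound_def[of m T "A \<union> B"]
      proof (rule cINF_greatest[OF ne])
        fix \<mu> assume \<mu>: "\<mu> \<in> mass_bounds m T"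
        then show "least_bound m T A + least_bound m T B \<le> \<mu> (A \<union> B)"
          using M0b_nonneg_add[OF mass_bounds_M0b_nonneg[OF \<mu>] A B AB]
            least_bound_le[OF \<mu>, of A] least_bound_le[OF \<mu>, of B] by simp
      qed
    qed
  next
    fix R :: "nat \<Rightarrow> 'a set"
    assume R: "\<And>n. R n \<in> bounded_borel" "decseq R" "(\<Inter>n. R n) = {}"
    show "(\<lambda>n. least_bound m T (R n)) \<longlonglongrightarrow> 0"
      using least_bound_le[OF \<mu>0] least_bound_nonneg[OF ne]
      by (intro tendsto_sandwich[OF _ _ tendsto_const M0b_nonneg_vanishing[OF \<mu>0' R]]) auto
  next
    fix U :: "'a set" assume U: "U \<in> bounded_borel"
    show "\<exists>K. sigma_compact K \<and> (\<forall>B\<in>sets borel. B \<subseteq> U \<longrightarrow> B \<inter> K = {} \<longrightarrow> least_bound m T B = 0)"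
      using M0b_nonneg_concentrated[OF \<mu>0' U] squeeze by metis
  qed (auto simp: squeeze M0b_nonneg_outside[OF \<mu>0'] least_bound_nonneg[OF ne])
qed

text \<open>Patching a bound that is good on \<open>A n\<close> into the previous one along
  \<open>A n\<close> leaves the values on the other, disjoint sets untouched, so finitely many sets
  can be treated one after another.\<close>

lemma least_bound_approx_disjoint:
  fixes A :: "nat \<Rightarrow> 'a::metric_space set"
  assumes T: "multilinear_functional m T" and ne: "mass_bounds m T \<noteq> {}" and e: "0 < e"
    and A: "\<And>i. A i \<in> bounded_borel" "disjoint_family A"
  shows "\<exists>\<kappa>\<in>mass_bounds m T. \<forall>i<n. \<kappa> (A i) \<le> least_bound m T (A i) + e"
proof (induction n)
  case 0
  then show ?case using ne by auto
next
  case (Suc n)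
  then obtain \<kappa> where \<kappa>: "\<kappa> \<in> mass_bounds m T" "\<And>i. i < n \<Longrightarrow> \<kappa> (A i) \<le> least_bound m T (A i) + e"
    by blast
  obtain \<mu> where \<mu>: "\<mu> \<in> mass_bounds m T" "\<mu> (A n) < least_bound m T (A n) + e"
    using least_bound_approx[OF ne e] by blast
  have "patch (A n) \<mu> \<kappa> (A i) \<le> least_bound m T (A i) + e" if "i < Suc n" for i
  proof (cases "i = n")
    case True
    then show ?thesis
      using \<mu> A(1) M0b_nonneg_empty[OF mass_bounds_M0b_nonneg[OF \<kappa>(1)]] by (simp add: patch_def)
  next
    case False
    then have "A i \<inter> A n = {}" "A i - A n = A i"
      using A(2) by (auto simp: disjoint_family_on_def)
    then show ?thesis
      using \<kappa>(2)[of i] False that A(1) M0b_nonneg_empty[OF mass_bounds_M0b_nonneg[OF \<mu>(1)]]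
      by (simp add: patch_def)
  qed
  then show ?case
    using mass_bounds_patch[OF T \<mu>(1) \<kappa>(1) bounded_borel_sets[OF A(1)]] by blast
qed

text \<open>On a level set of \<open>\<bar>f\<bar>\<close> the integrals of \<open>\<bar>f\<bar>\<close> are essentially determined by the measure of
  that set, and a single mass bound is nearly optimal on finitely many level sets at once.\<close>

lemma least_bound_mass_bounds:
  assumes T: "multilinear_functional m T" and ne: "mass_bounds m T \<noteq> {}"
  shows "least_bound m T \<in> mass_bounds m T"
  unfolding mass_bounds_iff
proof (intro conjI ballI)
  let ?\<nu> = "least_bound m T"
  show \<nu>: "?\<nu> \<in> M0b_nonneg" by (rule least_bound_M0b_nonneg[OF T ne])
  fix f :: "'a \<Rightarrow> real" and \<pi> :: "('a \<Rightarrow> real) list"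
  assume f: "f \<in> Lip_bs" and \<pi>: "\<pi> \<in> Lip_tuples m"
  define c where "c = (\<Prod>i<m. lip_const (\<pi> ! i))"
  have c: "0 \<le> c" unfolding c_def by (rule prod_lip_const_nonneg[OF \<pi>])
  have fm[measurable]: "f \<in> borel_measurable borel" by (rule Lip_bs_borel_measurable[OF f])
  have sb: "supp f \<in> bounded_borel" by (rule supp_bounded_borel[OF f])
  have sf[measurable]: "supp f \<in> sets borel" by (rule bounded_borel_sets[OF sb])
  obtain b where b: "0 \<le> b" "\<And>x. \<bar>f x\<bar> \<le> b" using Lip_bs_bounded[OF f] by blast
  let ?J = "\<lambda>\<kappa>. \<integral>\<^sup>+x. ennreal \<bar>f x\<bar> \<partial>borel_extension \<kappa>"
  have "ennreal \<bar>T f \<pi>\<bar> \<le> ennreal c * ?J ?\<nu>"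
  proof (rule ennreal_le_epsilon)
    fix e :: real assume e: "0 < e"
    \<comment> \<open>The width of the levels. Rounding \<open>\<bar>f\<bar>\<close> and the loss in
      the choice of \<open>\<kappa>\<close> will together cost at most
      \<open>c * d * (?\<nu> (supp f) + 1)\<close>; the added ones exclude zero factors.\<close>
    define d where "d = e / ((c + 1) * (?\<nu> (supp f) + 1))"
    have \<nu>s: "0 \<le> ?\<nu> (supp f)" by (rule M0b_nonneg_nonneg[OF \<nu>])
    have d: "0 < d" unfolding d_def using e c \<nu>s by (intro divide_pos_pos mult_pos_pos) auto
    \<comment> \<open>Level \<open>0\<close> is included, so zeros of \<open>f\<close> in the closed
      support are covered and the levels partition all of \<open>supp f\<close>.\<close>
    define A where "A i = {x \<in> supp f. real i * d \<le> \<bar>f x\<bar> \<and> \<bar>f x\<bar> < (real i + 1) * d}" for i :: nat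
    have Ab: "A i \<in> bounded_borel" for i
    proof -
      have "A i = supp f \<inter> {x \<in> space borel. real i * d \<le> \<bar>f x\<bar> \<and> \<bar>f x\<bar> < (real i + 1) * d}"
        by (auto simp: A_def)
      also have "\<dots> \<in> sets borel" by measurable
      finally show ?thesis by (intro bounded_borel_subset[OF sb]) (auto simp: A_def)
    qed
    have Ae: "i = nat \<lfloor>\<bar>f x\<bar> / d\<rfloor>" if "x \<in> A i" for i x
    proof -
      have "real i \<le> \<bar>f x\<bar> / d" "\<bar>f x\<bar> / d < real i + 1"
        using that d by (auto simp: A_def field_simps)
      then have "\<lfloor>\<bar>f x\<bar> / d\<rfloor> = int i" by (intro floor_unique) auto
      then show ?thesis by simp
    qed
    have Ax: "x \<in> A (nat \<lfloor>\<bar>f x\<bar> / d\<rfloor>)" if "x \<in> supp f" for x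
    proof -
      have "real (nat \<lfloor>\<bar>f x\<bar> / d\<rfloor>) = of_int \<lfloor>\<bar>f x\<bar> / d\<rfloor>" using d by simp
      then show ?thesis
        using that floor_divide_lower[OF d, of "\<bar>f x\<bar>"] floor_divide_upper[OF d, of "\<bar>f x\<bar>"]
        by (simp add: A_def)
    qed
    have Ad: "disjoint_family A"
      unfolding disjoint_family_on_def using Ae by blast
    obtain n :: nat where n: "b / d < real n" using reals_Archimedean2 by blast
    have nx: "nat \<lfloor>\<bar>f x\<bar> / d\<rfloor> < n" for x
    proof -
      have "\<bar>f x\<bar> / d \<le> b / d" using b d by (simp add: divide_right_mono)
      then have "\<lfloor>\<bar>f x\<bar> / d\<rfloor> < int n" using n by (simp add: floor_less_iff)
      moreover have "0 < n" using n b d by (cases n) (auto simp: field_simps)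
      ultimately show ?thesis by (simp add: nat_less_iff)
    qed
    \<comment> \<open>The excess on level \<open>i\<close> is weighted by
      \<open>(real i + 1) * d\<close>. Since the sum of \<open>(real i + 1) * \<delta>\<close> over
      \<open>i < n\<close> is at most \<open>1\<close>, the total excess is at most
      \<open>d\<close>.\<close>
    define \<delta> where "\<delta> = 1 / (real n + 1)^2"
    have \<delta>: "0 < \<delta>" by (simp add: \<delta>_def)
    obtain \<kappa> where \<kappa>: "\<kappa> \<in> mass_bounds m T" "\<And>i. i < n \<Longrightarrow> \<kappa> (A i) \<le> ?\<nu> (A i) + \<delta>"
      using least_bound_approx_disjoint[OF T ne \<delta> Ab Ad] by blast
    note \<kappa>' = mass_bounds_M0b_nonneg[OF \<kappa>(1)]
    have As: "A i \<in> sets borel" for i by (rule bounded_borel_sets[OF Ab])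
    have simple: "(\<integral>\<^sup>+x. (\<Sum>i<n. ennreal (a i) * indicator (A i) x) \<partial>borel_extension \<mu>) =
        ennreal (\<Sum>i<n. a i * \<mu> (A i))" if "\<mu> \<in> M0b_nonneg" "\<And>i. 0 \<le> a i" for \<mu> a
    proof -
      have "(\<integral>\<^sup>+x. (\<Sum>i<n. ennreal (a i) * indicator (A i) x) \<partial>borel_extension \<mu>) =
          (\<Sum>i<n. ennreal (a i) * ennreal (\<mu> (A i)))"
        using As by (subst nn_integral_sum)
          (auto simp: nn_integral_cmult_indicator emeasure_borel_extension[OF that(1) Ab])
      also have "\<dots> = ennreal (\<Sum>i<n. a i * \<mu> (A i))"
        using that by (simp add: ennreal_mult M0b_nonneg_nonneg sum_ennreal[symmetric])
      finally show ?thesis .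
    qed
    have sumA: "(\<Sum>i<n. ennreal (a i) * indicator (A i) x) =
        ennreal (a (nat \<lfloor>\<bar>f x\<bar> / d\<rfloor>)) * indicator (supp f) x" for a x
    proof -
      have "ennreal (a i) * indicator (A i) x =
          (if i = nat \<lfloor>\<bar>f x\<bar> / d\<rfloor> then ennreal (a i) * indicator (supp f) x else 0)" for i
      proof -
        have "x \<in> A i \<longleftrightarrow> x \<in> supp f \<and> i = nat \<lfloor>\<bar>f x\<bar> / d\<rfloor>"
        proof
          assume "x \<in> A i"
          then show "x \<in> supp f \<and> i = nat \<lfloor>\<bar>f x\<bar> / d\<rfloor>"
            using Ae by (simp add: A_def)
        next
          assume "x \<in> supp f \<and> i = nat \<lfloor>\<bar>f x\<bar> / d\<rfloor>"
          then show "x \<in> A i" using Ax by simp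
        qed
        then show ?thesis by (simp add: indicator_def)
      qed
      then show ?thesis using nx by (simp add: sum.delta')
    qed
    \<comment> \<open>The integral against \<open>\<kappa>\<close> is estimated with the upper ends
      of the levels, the one against \<open>?\<nu>\<close> with the lower ends; the gap is
      \<open>d\<close> times the measure of the support, up to the excess of
      \<open>\<kappa>\<close>.\<close>
    have up: "?J \<kappa> \<le> ennreal (\<Sum>i<n. (real i + 1) * d * \<kappa> (A i))"
    proof -
      have "ennreal \<bar>f x\<bar> \<le> (\<Sum>i<n. ennreal ((real i + 1) * d) * indicator (A i) x)" for x
      proof (cases "x \<in> supp f")
        case True
        then show ?thesis using Ax[OF True] unfolding sumA by (auto simp: A_def intro!: ennreal_leI)
      qed (simp add: supp_zero)
      then have "?J \<kappa> \<le> (\<integral>\<^sup>+x. (\<Sum>i<n. ennreal ((real i + 1) * d) * indicator (A i) x) \<partial>borel_extension \<kappa>)"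
        by (intro nn_integral_mono)
      also have "\<dots> = ennreal (\<Sum>i<n. (real i + 1) * d * \<kappa> (A i))"
        using d by (intro simple[OF \<kappa>']) auto
      finally show ?thesis .
    qed
    have lo: "ennreal (\<Sum>i<n. real i * d * ?\<nu> (A i)) \<le> ?J ?\<nu>"
    proof -
      have "ennreal (\<Sum>i<n. real i * d * ?\<nu> (A i)) =
          (\<integral>\<^sup>+x. (\<Sum>i<n. ennreal (real i * d) * indicator (A i) x) \<partial>borel_extension ?\<nu>)"
        using d by (intro simple[OF \<nu>, symmetric]) auto
      also have "\<dots> \<le> ?J ?\<nu>"
      proof (intro nn_integral_mono)
        fix x
        show "(\<Sum>i<n. ennreal (real i * d) * indicator (A i) x) \<le> ennreal \<bar>f x\<bar>"
          using Ax[of x] unfolding sumA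
          by (cases "x \<in> supp f") (auto simp: A_def intro!: ennreal_leI)
      qed
      finally show ?thesis .
    qed
    have mid: "(\<Sum>i<n. ?\<nu> (A i)) \<le> ?\<nu> (supp f)"
    proof -
      have "ennreal (\<Sum>i<n. 1 * ?\<nu> (A i)) =
          (\<integral>\<^sup>+x. (\<Sum>i<n. ennreal 1 * indicator (A i) x) \<partial>borel_extension ?\<nu>)"
        by (intro simple[OF \<nu>, symmetric]) auto
      also have "\<dots> = ennreal (?\<nu> (supp f))"
        unfolding sumA using emeasure_borel_extension[OF \<nu> sb] by simp
      finally show ?thesis using \<nu>s by (simp add: ennreal_inj sum_nonneg M0b_nonneg_nonneg[OF \<nu>])
    qed
    have "(\<Sum>i<n. (real i + 1) * d * \<kappa> (A i)) \<le> (\<Sum>i<n. (real i + 1) * d * (?\<nu> (A i) + \<delta>))"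
      using \<kappa>(2) d by (intro sum_mono mult_left_mono) auto
    also have "\<dots> = (\<Sum>i<n. real i * d * ?\<nu> (A i)) + d * (\<Sum>i<n. ?\<nu> (A i)) + d * (\<Sum>i<n. (real i + 1) * \<delta>)"
      by (simp add: algebra_simps sum.distrib sum_distrib_left)
    also have "\<dots> \<le> (\<Sum>i<n. real i * d * ?\<nu> (A i)) + d * ?\<nu> (supp f) + d * 1"
    proof -
      have "(\<Sum>i<n. (real i + 1) * \<delta>) \<le> (\<Sum>i<n. (real n + 1) * \<delta>)"
        using \<delta> by (intro sum_mono mult_right_mono) auto
      also have "\<dots> = real n / (real n + 1)" by (simp add: \<delta>_def power2_eq_square)
      also have "\<dots> \<le> 1" by simp
      finally show ?thesis using mid d by (intro add_mono mult_left_mono) auto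
    qed
    finally have "?J \<kappa> \<le> ennreal ((\<Sum>i<n. real i * d * ?\<nu> (A i)) + d * (?\<nu> (supp f) + 1))"
      using up by (elim order_trans) (auto intro!: ennreal_leI simp: algebra_simps)
    also have "\<dots> = ennreal (\<Sum>i<n. real i * d * ?\<nu> (A i)) + ennreal (d * (?\<nu> (supp f) + 1))"
      using d \<nu>s by (intro ennreal_plus) (auto intro!: sum_nonneg mult_nonneg_nonneg M0b_nonneg_nonneg[OF \<nu>])
    also have "\<dots> \<le> ?J ?\<nu> + ennreal (d * (?\<nu> (supp f) + 1))"
      by (intro add_right_mono lo)
    finally have J: "?J \<kappa> \<le> ?J ?\<nu> + ennreal (d * (?\<nu> (supp f) + 1))" .
    have "ennreal \<bar>T f \<pi>\<bar> \<le> ennreal c * ?J \<kappa>"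
      using mass_boundsD[OF \<kappa>(1) f \<pi>] by (simp add: c_def)
    also have "\<dots> \<le> ennreal c * (?J ?\<nu> + ennreal (d * (?\<nu> (supp f) + 1)))"
      by (intro mult_left_mono J) auto
    also have "\<dots> = ennreal c * ?J ?\<nu> + ennreal (c * (d * (?\<nu> (supp f) + 1)))"
      using c d \<nu>s by (simp add: distrib_left ennreal_mult[symmetric])
    also have "\<dots> \<le> ennreal c * ?J ?\<nu> + ennreal e"
    proof (intro add_left_mono ennreal_leI)
      have "d * (?\<nu> (supp f) + 1) = e / (c + 1)"
        using \<nu>s c unfolding d_def by (simp add: divide_simps)
      then have "c * (d * (?\<nu> (supp f) + 1)) = e * (c / (c + 1))" by simp
      also have "\<dots> \<le> e * 1" using e c by (intro mult_left_mono) auto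
      finally show "c * (d * (?\<nu> (supp f) + 1)) \<le> e" by simp
    qed
    finally show "ennreal \<bar>T f \<pi>\<bar> \<le> ennreal c * ?J ?\<nu> + ennreal e" .
  qed
  then show "ennreal \<bar>T f \<pi>\<bar> \<le> ennreal (\<Prod>i<m. lip_const (\<pi> ! i)) * ?J ?\<nu>"
    by (simp add: c_def)
qed

text \<open>The definite description in \<open>mass\<close> has a unique solution: two least bounds
  agree on bounded Borel sets by minimality and elsewhere by the default value
  \<open>0\<close>.\<close>

lemma mass_eq:
  assumes T: "multilinear_functional m T" and ne: "mass_bounds m T \<noteq> {}"
  shows "mass m T = borel_extension (least_bound m T)"
proof -
  have "(THE \<mu>. \<mu> \<in> mass_bounds m T \<and> (\<forall>\<nu>\<in>mass_bounds m T. \<forall>B\<in>bounded_borel. \<mu> B \<le> \<nu> B)) =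
      least_bound m T"
  proof (rule the_equality)
    fix \<mu> assume \<mu>: "\<mu> \<in> mass_bounds m T \<and> (\<forall>\<nu>\<in>mass_bounds m T. \<forall>B\<in>bounded_borel. \<mu> B \<le> \<nu> B)"
    show "\<mu> = least_bound m T"
    proof
      fix B
      show "\<mu> B = least_bound m T B"
      proof (cases "B \<in> bounded_borel")
        case True
        then show ?thesis
          using \<mu> least_bound_mass_bounds[OF T ne] least_bound_le[of \<mu> m T B] by (auto intro: antisym)
      next
        case False
        then show ?thesis
          using \<mu> M0b_nonneg_outside[OF least_bound_M0b_nonneg[OF T ne]]
            M0b_nonneg_outside[OF mass_bounds_M0b_nonneg, of \<mu> m T] by simp
      qed
    qed
  qed (use least_bound_mass_bounds[OF T ne] least_bound_le in auto)
  then show ?thesis by (simp add: mass_def)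
qed

section \<open>Currents and their masses\<close>

lemma currentsD:
  assumes "T \<in> currents m"
  shows "multilinear_functional m T" "mass_bounds m T \<noteq> {}"
  using assms by (auto simp: currents_def)

lemma currents_least_bound:
  assumes "T \<in> currents m"
  shows "least_bound m T \<in> mass_bounds m T"
  using least_bound_mass_bounds currentsD[OF assms] by blast

lemma currents_least_bound_M0b_nonneg:
  assumes "T \<in> currents m"
  shows "least_bound m T \<in> M0b_nonneg"
  using least_bound_M0b_nonneg currentsD[OF assms] by blast

text \<open>The triangle inequality, stated for differences because subcurrents involve
  \<open>T - S\<close>; sums are recovered later as \<open>S - (0 - T)\<close>.\<close>

lemma mass_bounds_diff:
  assumes \<mu>: "\<mu> \<in> mass_bounds m S" and \<nu>: "\<nu> \<in> mass_bounds m T"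
  shows "(\<lambda>B. \<mu> B + \<nu> B) \<in> mass_bounds m (S - T)"
  unfolding mass_bounds_iff
proof (intro conjI ballI)
  note \<mu>0 = mass_bounds_M0b_nonneg[OF \<mu>] and \<nu>0 = mass_bounds_M0b_nonneg[OF \<nu>]
  show "(\<lambda>B. \<mu> B + \<nu> B) \<in> M0b_nonneg" by (rule M0b_nonneg_plus[OF \<mu>0 \<nu>0])
  fix f :: "'a \<Rightarrow> real" and \<pi> :: "('a \<Rightarrow> real) list"
  assume f: "f \<in> Lip_bs" and \<pi>: "\<pi> \<in> Lip_tuples m"
  let ?c = "ennreal (\<Prod>i<m. lip_const (\<pi> ! i))"
  have "ennreal \<bar>(S - T) f \<pi>\<bar> \<le> ennreal (\<bar>S f \<pi>\<bar> + \<bar>T f \<pi>\<bar>)"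
    by (intro ennreal_leI) simp
  also have "\<dots> = ennreal \<bar>S f \<pi>\<bar> + ennreal \<bar>T f \<pi>\<bar>" by simp
  also have "\<dots> \<le> ?c * (\<integral>\<^sup>+x. ennreal \<bar>f x\<bar> \<partial>borel_extension \<mu>) +
      ?c * (\<integral>\<^sup>+x. ennreal \<bar>f x\<bar> \<partial>borel_extension \<nu>)"
    by (intro add_mono mass_boundsD[OF \<mu> f \<pi>] mass_boundsD[OF \<nu> f \<pi>])
  also have "\<dots> = ?c * (\<integral>\<^sup>+x. ennreal \<bar>f x\<bar> \<partial>borel_extension (\<lambda>B. \<mu> B + \<nu> B))"
    using Lip_bs_borel_measurable[OF f]
    by (subst nn_integral_borel_extension_plus[OF \<mu>0 \<nu>0]) (auto simp: distrib_left)
  finally show "ennreal \<bar>(S - T) f \<pi>\<bar> \<le>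
      ?c * (\<integral>\<^sup>+x. ennreal \<bar>f x\<bar> \<partial>borel_extension (\<lambda>B. \<mu> B + \<nu> B))" .
qed

lemma mass_bounds_zero: "(\<lambda>B. 0) \<in> mass_bounds m 0"
  by (simp add: mass_bounds_iff M0b_nonneg_zero)

lemma currents_zero: "0 \<in> currents m"
  using mass_bounds_zero
  by (auto simp: currents_def multilinear_functional_def continuous_functional_def local_functional_def)

lemma currents_diff:
  assumes S: "S \<in> currents m" and T: "T \<in> currents m"
  shows "S - T \<in> currents m"
proof -
  have "multilinear_functional m (S - T)"
    using currentsD(1)[OF S] currentsD(1)[OF T]
    unfolding multilinear_functional_def by (simp add: algebra_simps)
  moreover have "continuous_functional m (S - T)"
    unfolding continuous_functional_def
  proof (intro ballI allI impI)
    fix f :: "'a \<Rightarrow> real" and \<pi> and \<pi>s :: "nat \<Rightarrow> ('a \<Rightarrow> real) list"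
    assume *: "f \<in> Lip_bs" "\<pi> \<in> Lip_tuples m" "\<forall>j. \<pi>s j \<in> Lip_tuples m"
      "\<forall>i<m. \<forall>x. (\<lambda>j. (\<pi>s j ! i) x) \<longlonglongrightarrow> (\<pi> ! i) x"
      "\<exists>L. \<forall>j. \<forall>i<m. lip_const (\<pi>s j ! i) \<le> L"
    have "(\<lambda>j. S f (\<pi>s j)) \<longlonglongrightarrow> S f \<pi>" "(\<lambda>j. T f (\<pi>s j)) \<longlonglongrightarrow> T f \<pi>"
      using S T * unfolding currents_def continuous_functional_def by blast+
    then show "(\<lambda>j. (S - T) f (\<pi>s j)) \<longlonglongrightarrow> (S - T) f \<pi>"
      by (simp add: tendsto_diff)
  qed
  moreover have "local_functional m (S - T)"
    using S T by (simp add: currents_def local_functional_def)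
  moreover have "mass_bounds m (S - T) \<noteq> {}"
    using mass_bounds_diff currentsD(2)[OF S] currentsD(2)[OF T] by blast
  ultimately show ?thesis
    using S T by (auto simp: currents_def)
qed

lemma least_bound_diff_le:
  assumes "S \<in> currents m" "T \<in> currents m"
  shows "least_bound m (S - T) B \<le> least_bound m S B + least_bound m T B"
  by (rule least_bound_le[OF mass_bounds_diff[OF currents_least_bound currents_least_bound]])
    (rule assms)+

lemma least_bound_zero: "least_bound m 0 B = 0"
  using least_bound_le[OF mass_bounds_zero, of m B]
    least_bound_nonneg[OF currentsD(2)[OF currents_zero], of m B] by simp

lemma currents_add:
  assumes "S \<in> currents m" "T \<in> currents m"
  shows "S + T \<in> currents m"
  using currents_diff[OF assms(1) currents_diff[OF currents_zero assms(2)]] by simp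

lemma least_bound_add_le:
  assumes "S \<in> currents m" "T \<in> currents m"
  shows "least_bound m (S + T) B \<le> least_bound m S B + least_bound m T B"
  using least_bound_diff_le[OF assms(1) currents_diff[OF currents_zero assms(2)], of B]
    least_bound_diff_le[OF currents_zero assms(2), of B]
  by (simp add: least_bound_zero)

text \<open>The support of a test function lies in some ball, hence is a null set, and the mass
  inequality annihilates \<open>T\<close> there.\<close>

lemma current_eq_zeroI:
  assumes T: "T \<in> currents m" and zero: "\<And>n::nat. least_bound m T (ball c (real n)) = 0"
  shows "T = 0"
proof -
  note \<mu> = currents_least_bound[OF T] and \<mu>0 = currents_least_bound_M0b_nonneg[OF T]
  have "T f \<pi> = 0" for f \<pi>
  proof (cases "f \<in> Lip_bs \<and> \<pi> \<in> Lip_tuples m")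
    case True
    then have f: "f \<in> Lip_bs" and \<pi>: "\<pi> \<in> Lip_tuples m" by auto
    have sf: "supp f \<in> bounded_borel" by (rule supp_bounded_borel[OF f])
    then obtain n :: nat where n: "supp f \<subseteq> ball c (real n)"
      using bounded_subset_nat_ball by (auto simp: bounded_borel_def)
    have "least_bound m T (supp f) = 0"
      using M0b_nonneg_mono[OF \<mu>0 bounded_borel_ball bounded_borel_sets[OF sf] n]
        M0b_nonneg_nonneg[OF \<mu>0, of "supp f"] by (simp add: zero)
    moreover obtain b where "\<And>x. \<bar>f x\<bar> \<le> b" using Lip_bs_bounded[OF f] by blast
    ultimately have "(\<integral>\<^sup>+x. ennreal \<bar>f x\<bar> \<partial>borel_extension (least_bound m T)) = 0"
      using nn_integral_Lip_bs_le[OF \<mu>0 f] by fastforce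
    then show ?thesis using mass_boundsD[OF \<mu> f \<pi>] by simp
  next
    case False
    then show ?thesis using T by (auto simp: currents_def)
  qed
  then show ?thesis by (simp add: fun_eq_iff)
qed

section \<open>Subcurrents in terms of real-valued masses\<close>

text \<open>On bounded sets all masses are finite, so the identity in \<open>ennreal\<close> becomes
  one between reals, which can be rearranged. Exhaustion by balls gives it back on all Borel
  sets.\<close>

lemma subcurrent_iff:
  "subcurrent m S T \<longleftrightarrow> S \<in> currents m \<and> T \<in> currents m \<and>
    (\<forall>B\<in>bounded_borel. least_bound m T B = least_bound m S B + least_bound m (T - S) B)"
proof (cases "S \<in> currents m \<and> T \<in> currents m")
  case True
  then have S: "S \<in> currents m" and T: "T \<in> currents m" and D: "T - S \<in> currents m"
    by (auto intro: currents_diff)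
  note \<mu>S = currents_least_bound_M0b_nonneg[OF S] and \<mu>T = currents_least_bound_M0b_nonneg[OF T]
    and \<mu>D = currents_least_bound_M0b_nonneg[OF D]
  have mass: "mass m X = borel_extension (least_bound m X)" if "X \<in> currents m" for X
    using mass_eq currentsD[OF that] by blast
  have "(\<forall>B\<in>sets borel. emeasure (mass m T) B = emeasure (mass m S) B + emeasure (mass m (T - S)) B)
    \<longleftrightarrow> (\<forall>B\<in>bounded_borel. least_bound m T B = least_bound m S B + least_bound m (T - S) B)"
    (is "?L \<longleftrightarrow> ?R")
  proof
    assume L: ?L
    show ?R
    proof
      fix B :: "'a set" assume B: "B \<in> bounded_borel"
      have "ennreal (least_bound m T B) = ennreal (least_bound m S B) + ennreal (least_bound m (T - S) B)"
        using L[rule_format, OF bounded_borel_sets[OF B]]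
        unfolding mass[OF S] mass[OF T] mass[OF D] emeasure_borel_extension[OF \<mu>S B]
          emeasure_borel_extension[OF \<mu>T B] emeasure_borel_extension[OF \<mu>D B] .
      also have "\<dots> = ennreal (least_bound m S B + least_bound m (T - S) B)"
        by (simp add: M0b_nonneg_nonneg[OF \<mu>S] M0b_nonneg_nonneg[OF \<mu>D])
      finally show "least_bound m T B = least_bound m S B + least_bound m (T - S) B"
        by (simp add: ennreal_inj M0b_nonneg_nonneg[OF \<mu>T] M0b_nonneg_nonneg[OF \<mu>S] M0b_nonneg_nonneg[OF \<mu>D]
            del: ennreal_plus)
    qed
  next
    assume ?R
    then show ?L
      using emeasure_borel_extension_plus[OF \<mu>S \<mu>D \<mu>T] by (simp add: mass S T D)
  qed
  then show ?thesis using True by (simp add: subcurrent_def)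
qed (auto simp: subcurrent_def)

text \<open>One inequality suffices; the other is the triangle inequality for
  \<open>T = S + (T - S)\<close>.\<close>

lemma subcurrentI:
  assumes "S \<in> currents m" "T \<in> currents m"
    and "\<And>B. B \<in> bounded_borel \<Longrightarrow> least_bound m S B + least_bound m (T - S) B \<le> least_bound m T B"
  shows "subcurrent m S T"
proof -
  have "least_bound m T B \<le> least_bound m S B + least_bound m (T - S) B" for B
    using least_bound_add_le[OF assms(1) currents_diff[OF assms(2,1)], of B] by simp
  then show ?thesis
    using assms by (auto simp: subcurrent_iff intro!: antisym)
qed

lemma zero_cycle_of:
  assumes "T \<in> currents m"
  shows "cycle_of m 0 T"
proof -
  have "subcurrent m 0 T"
    using assms by (intro subcurrentI currents_zero) (simp_all add: least_bound_zero)
  then show ?thesis by (auto simp: cycle_of_def boundary_def fun_eq_iff)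
qed

text \<open>Local summability of the masses gives the values of the \<open>C k\<close> a summable
  majorant that depends on the arguments only through \<open>f\<close> and the Lipschitz constants.
  Hence the uniform Lipschitz bound in the continuity axiom allows limit and series to be exchanged,
  and the sum of the masses is a mass bound of the limit.\<close>

lemma currents_suminf:
  fixes C :: "nat \<Rightarrow> 'a::metric_space functional"
  assumes C: "\<And>k. C k \<in> currents m"
    and sm: "\<And>B. B \<in> bounded_borel \<Longrightarrow> summable (\<lambda>k. least_bound m (C k) B)"
  shows summable_current_values: "\<And>f \<pi>. summable (\<lambda>k. C k f \<pi>)"
    and suminf_in_currents: "(\<lambda>f \<pi>. \<Sum>k. C k f \<pi>) \<in> currents m"
    and least_bound_suminf_le:
      "\<And>B. least_bound m (\<lambda>f \<pi>. \<Sum>k. C k f \<pi>) B \<le> (\<Sum>k. least_bound m (C k) B)"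
proof -
  note \<mu> = currents_least_bound[OF C] and \<mu>0 = currents_least_bound_M0b_nonneg[OF C]
  let ?S = "\<lambda>f \<pi>. \<Sum>k. C k f \<pi>"
  let ?\<nu> = "\<lambda>B. \<Sum>k. least_bound m (C k) B"
  have \<nu>: "?\<nu> \<in> M0b_nonneg" by (rule M0b_nonneg_suminf[OF \<mu>0 sm])
  define a where "a f k = (\<integral>x. \<bar>f x\<bar> \<partial>borel_extension (least_bound m (C k)))" for f :: "'a \<Rightarrow> real" and k
  have a0: "0 \<le> a f k" for f k by (simp add: a_def)
  have nn: "(\<integral>\<^sup>+x. ennreal \<bar>f x\<bar> \<partial>borel_extension ?\<nu>) = (\<Sum>k. ennreal (a f k))" if "f \<in> Lip_bs" for f
  proof -
    have "(\<lambda>x. ennreal \<bar>f x\<bar>) \<in> borel_measurable borel"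
      using Lip_bs_borel_measurable[OF that] by measurable
    from nn_integral_borel_extension_suminf[OF \<mu>0 sm this] show ?thesis
      unfolding nn_integral_Lip_bs[OF \<mu>0 that] a_def .
  qed
  \<comment> \<open>The series of the \<open>a f k\<close> is the integral of
    \<open>\<bar>f\<bar>\<close> against the sum of the masses, finite because that sum is locally
    finite.\<close>
  have asm: "summable (a f)" if "f \<in> Lip_bs" for f
    using nn_integral_Lip_bs_finite[OF \<nu> that] nn[OF that] a0
    by (intro summable_suminf_not_top) auto
  have bound: "\<bar>C k f \<pi>\<bar> \<le> (\<Prod>i<m. lip_const (\<pi> ! i)) * a f k"
    if "f \<in> Lip_bs" "\<pi> \<in> Lip_tuples m" for k f \<pi>
    using \<mu>[of k] that by (auto simp: mass_bounds_def a_def)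
  have abs: "summable (\<lambda>k. \<bar>C k f \<pi>\<bar>)" if "f \<in> Lip_bs" "\<pi> \<in> Lip_tuples m" for f \<pi>
    using bound[OF that] asm[OF that(1)]
    by (intro summable_comparison_test'[OF summable_mult[OF asm[OF that(1)]]]) auto
  have out: "C k f \<pi> = 0" if "\<not> (f \<in> Lip_bs \<and> \<pi> \<in> Lip_tuples m)" for k f \<pi>
    using C[of k] that by (auto simp: currents_def)
  show s: "summable (\<lambda>k. C k f \<pi>)" for f \<pi>
    by (cases "f \<in> Lip_bs \<and> \<pi> \<in> Lip_tuples m") (auto simp: out intro: summable_rabs_cancel abs)
  have "multilinear_functional m ?S"
  proof -
    have "C k (\<lambda>x. a * f x + b * g x) \<pi> = a * C k f \<pi> + b * C k g \<pi>"
      if "f \<in> Lip_bs" "g \<in> Lip_bs" "\<pi> \<in> Lip_tuples m" for k f g \<pi> a b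
      using currentsD(1)[OF C[of k]] that unfolding multilinear_functional_def by simp
    moreover have "C k f (\<pi>[i := (\<lambda>x. a * u x + b * v x)]) = a * C k f (\<pi>[i := u]) + b * C k f (\<pi>[i := v])"
      if "f \<in> Lip_bs" "\<pi> \<in> Lip_tuples m" "i < m" "u \<in> Lip" "v \<in> Lip" for k f i u v \<pi> a b
      using currentsD(1)[OF C[of k]] that unfolding multilinear_functional_def by simp
    ultimately show ?thesis
      unfolding multilinear_functional_def
      by (simp add: suminf_add[symmetric] suminf_mult[symmetric] summable_mult s)
  qed
  moreover have "continuous_functional m ?S"
    unfolding continuous_functional_def
  proof (intro ballI allI impI)
    fix f :: "'a \<Rightarrow> real" and \<pi> and \<pi>s :: "nat \<Rightarrow> ('a \<Rightarrow> real) list"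
    assume f: "f \<in> Lip_bs" and \<pi>: "\<pi> \<in> Lip_tuples m" and \<pi>s: "\<forall>j. \<pi>s j \<in> Lip_tuples m"
      and lim: "\<forall>i<m. \<forall>x. (\<lambda>j. (\<pi>s j ! i) x) \<longlonglongrightarrow> (\<pi> ! i) x"
      and L: "\<exists>L. \<forall>j. \<forall>i<m. lip_const (\<pi>s j ! i) \<le> L"
    from L obtain L where L': "\<And>j i. i < m \<Longrightarrow> lip_const (\<pi>s j ! i) \<le> L" by blast
    have p: "(\<Prod>i<m. lip_const (\<pi>s j ! i)) \<le> \<bar>L\<bar> ^ m" for j
    proof -
      have "\<pi>s j ! i \<in> Lip" if "i < m" for i
        using \<pi>s[rule_format, of j] that nth_mem[of i "\<pi>s j"] by (auto simp: Lip_tuples_def)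
      then have "(\<Prod>i<m. lip_const (\<pi>s j ! i)) \<le> (\<Prod>i<m. \<bar>L\<bar>)"
        using L' by (intro prod_mono) (auto intro: lip_const_nonneg order_trans[OF _ abs_ge_self])
      then show ?thesis by simp
    qed
    have b: "norm (C k f (\<pi>s j)) \<le> \<bar>L\<bar> ^ m * a f k" for k j
    proof -
      have "\<bar>C k f (\<pi>s j)\<bar> \<le> (\<Prod>i<m. lip_const (\<pi>s j ! i)) * a f k"
        using bound[OF f] \<pi>s by blast
      also have "\<dots> \<le> \<bar>L\<bar> ^ m * a f k" by (intro mult_right_mono p a0)
      finally show ?thesis by simp
    qed
    show "(\<lambda>j. ?S f (\<pi>s j)) \<longlonglongrightarrow> ?S f \<pi>"
    proof (rule tannerys_theorem[THEN conjunct2, THEN conjunct2])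
      show "(\<lambda>j. C k f (\<pi>s j)) \<longlonglongrightarrow> C k f \<pi>" for k
        using C[of k] f \<pi> \<pi>s lim L unfolding currents_def continuous_functional_def by blast
      show "\<forall>\<^sub>F (k, j) in sequentially \<times>\<^sub>F sequentially. norm (C k f (\<pi>s j)) \<le> \<bar>L\<bar> ^ m * a f k"
        using b by (intro always_eventually) auto
      show "summable (\<lambda>k. \<bar>L\<bar> ^ m * a f k)" by (intro summable_mult asm f)
    qed simp
  qed
  moreover have "local_functional m ?S"
  proof -
    have "C k f \<pi> = 0" if "f \<in> Lip_bs" "\<pi> \<in> Lip_tuples m" "\<exists>i<m. \<forall>x\<in>supp f. (\<pi> ! i) x = 0" for k f \<pi>
      using C[of k] that unfolding currents_def local_functional_def by blast
    then show ?thesis unfolding local_functional_def by simp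
  qed
  moreover have mb: "?\<nu> \<in> mass_bounds m ?S"
    unfolding mass_bounds_iff
  proof (intro conjI ballI \<nu>)
    fix f :: "'a \<Rightarrow> real" and \<pi> :: "('a \<Rightarrow> real) list"
    assume f: "f \<in> Lip_bs" and \<pi>: "\<pi> \<in> Lip_tuples m"
    let ?c = "\<Prod>i<m. lip_const (\<pi> ! i)"
    have c: "0 \<le> ?c" by (rule prod_lip_const_nonneg[OF \<pi>])
    have "\<bar>?S f \<pi>\<bar> \<le> (\<Sum>k. \<bar>C k f \<pi>\<bar>)" by (rule summable_rabs[OF abs[OF f \<pi>]])
    also have "\<dots> \<le> (\<Sum>k. ?c * a f k)"
      by (intro suminf_le abs summable_mult asm bound f \<pi>)
    also have "\<dots> = ?c * (\<Sum>k. a f k)" by (rule suminf_mult[OF asm[OF f]])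
    finally have "ennreal \<bar>?S f \<pi>\<bar> \<le> ennreal (?c * (\<Sum>k. a f k))" by (rule ennreal_leI)
    also have "\<dots> = ennreal ?c * (\<integral>\<^sup>+x. ennreal \<bar>f x\<bar> \<partial>borel_extension ?\<nu>)"
      using c a0 asm[OF f] by (simp add: nn[OF f] suminf_ennreal2 ennreal_mult suminf_nonneg)
    finally show "ennreal \<bar>?S f \<pi>\<bar> \<le> ennreal ?c * (\<integral>\<^sup>+x. ennreal \<bar>f x\<bar> \<partial>borel_extension ?\<nu>)" .
  qed
  ultimately show "?S \<in> currents m"
    by (auto simp: currents_def out)
  show "least_bound m ?S B \<le> ?\<nu> B" for B
    by (rule least_bound_le[OF mb])
qed

section \<open>Greedy choice of cycles and the decomposition\<close>

text \<open>Masses of cycles on the bounded set \<open>U\<close> are at most the finite mass of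
  \<open>T\<close> there, so their supremum exists. If it is positive, some cycle exceeds half of
  it; otherwise the zero cycle serves.\<close>

lemma greedy_cycle_exists:
  assumes T: "T \<in> currents m" and U: "U \<in> bounded_borel"
  shows "\<exists>C. cycle_of m C T \<and> (\<forall>C'. cycle_of m C' T \<longrightarrow> least_bound m C' U \<le> 2 * least_bound m C U)"
proof -
  let ?X = "{least_bound m C U |C. cycle_of m C T}"
  have "x \<le> least_bound m T U" if "x \<in> ?X" for x
  proof -
    from that obtain C where C: "cycle_of m C T" "x = least_bound m C U" by blast
    then have "T - C \<in> currents m" by (auto simp: cycle_of_def subcurrent_iff intro: currents_diff)
    then show ?thesis
      using C U least_bound_nonneg[OF currentsD(2), of "T - C" m U]
      by (auto simp: cycle_of_def subcurrent_iff)
  qed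
  then have bdd: "bdd_above ?X" by (rule bdd_aboveI)
  have upper: "least_bound m C U \<le> Sup ?X" if "cycle_of m C T" for C
    using that by (intro cSup_upper bdd) blast
  show ?thesis
  proof (cases "Sup ?X \<le> 0")
    case True
    have "least_bound m C' U \<le> 2 * least_bound m 0 U" if "cycle_of m C' T" for C'
      using upper[OF that] True by (simp add: least_bound_zero)
    then show ?thesis using zero_cycle_of[OF T] by blast
  next
    case False
    then have "Sup ?X / 2 < Sup ?X" by simp
    moreover have "?X \<noteq> {}" using zero_cycle_of[OF T] by blast
    ultimately obtain C where "cycle_of m C T" "Sup ?X / 2 < least_bound m C U"
      using less_cSup_iff[OF _ bdd, of "Sup ?X / 2"] by blast
    then show ?thesis using upper by (intro exI[of _ C]) fastforce
  qed
qed

theorem theorem8: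
  fixes T :: "'a::metric_space functional" and m :: nat
  assumes "m \<ge> 1" and "T \<in> currents m"
  shows "(\<exists>C. cycle_of m C T \<and> acyclic_current m (T - C)) \<and>
         (\<exists>A C. T = A + C \<and> cycle_of m C T \<and> acyclic_current m A)"
proof -
  note T = assms(2)
  let ?N = "least_bound m"
  \<comment> \<open>Radius \<open>j\<close> is used exactly at the indices
    \<open>prod_encode (j, i)\<close>, one for each \<open>i\<close>.\<close>
  define U :: "nat \<Rightarrow> 'a set" where "U k = ball undefined (real (fst (prod_decode k)))" for k
  have U: "U k \<in> bounded_borel" for k by (simp add: U_def bounded_borel_ball)
  \<comment> \<open>The choice is total in \<open>S\<close> so that the recursion can be written
    down, but it is meaningful only when \<open>S\<close> is a current; this is established along
    the recursion.\<close>
  define pick where "pick k S = (SOME C. cycle_of m C (T - S) \<and>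
    (\<forall>C'. cycle_of m C' (T - S) \<longrightarrow> ?N C' (U k) \<le> 2 * ?N C (U k)))" for k S
  define S where "S = rec_nat 0 (\<lambda>k X. X + pick k X)"
  define C where "C k = pick k (S k)" for k
  have S0: "S 0 = 0" and SSuc: "S (Suc k) = S k + C k" for k
    by (simp_all add: S_def C_def)
  have pick: "cycle_of m (C k) (T - S k)"
      "cycle_of m C' (T - S k) \<Longrightarrow> ?N C' (U k) \<le> 2 * ?N (C k) (U k)"
    if "S k \<in> currents m" for k C'
    using someI_ex[OF greedy_cycle_exists[OF currents_diff[OF T that] U[of k]]]
    unfolding C_def pick_def by blast+
  have Sc: "S k \<in> currents m" for k
  proof (induction k)
    case (Suc k)
    have "C k \<in> currents m"
      using pick(1)[OF Suc] by (simp add: cycle_of_def subcurrent_iff)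
    then show ?case unfolding SSuc by (rule currents_add[OF Suc])
  qed (unfold S0, rule currents_zero)
  have Cc: "C k \<in> currents m" for k
    using pick(1)[OF Sc] by (auto simp: cycle_of_def subcurrent_iff)
  \<comment> \<open>Each \<open>C n\<close> is a subcurrent of \<open>T - S n\<close>, with
    remainder \<open>T - S (Suc n)\<close>; the mass identities telescope.\<close>
  have split: "?N T B = (\<Sum>k<n. ?N (C k) B) + ?N (T - S n) B" if "B \<in> bounded_borel" for B n
  proof (induction n)
    case (Suc n)
    have "?N (T - S n) B = ?N (C n) B + ?N (T - S (Suc n)) B"
      using pick(1)[OF Sc[of n]] that by (simp add: cycle_of_def subcurrent_iff SSuc diff_diff_eq)
    with Suc.IH show ?case by (simp only: sum.lessThan_Suc add.assoc)
  qed (simp add: S0)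
  have nonneg: "0 \<le> ?N X B" if "X \<in> currents m" for X B
    using least_bound_nonneg currentsD(2)[OF that] by blast
  have sm: "summable (\<lambda>k. ?N (C k) B)" if "B \<in> bounded_borel" for B
  proof (rule summableI_nonneg_bounded)
    show "(\<Sum>k<n. ?N (C k) B) \<le> ?N T B" for n
      using split[OF that, of n] nonneg[OF currents_diff[OF T Sc], of n B] by simp
  qed (rule nonneg[OF Cc])
  define D where "D = (\<lambda>f \<pi>. \<Sum>k. C k f \<pi>)"
  have Dc: "D \<in> currents m"
    unfolding D_def by (rule suminf_in_currents[OF Cc sm])
  have Ssum: "S n f \<pi> = (\<Sum>k<n. C k f \<pi>)" for n f \<pi>
    by (induction n) (simp_all add: S0 SSuc)
  \<comment> \<open>\<open>D - S n\<close> is the series of the cycles from index \<open>n\<close>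
    on, so its mass is at most the tail of the masses.\<close>
  have tail: "?N (D - S n) B \<le> (\<Sum>k. ?N (C k) B) - (\<Sum>k<n. ?N (C k) B)"
    if B: "B \<in> bounded_borel" for n B
  proof -
    have "D - S n = (\<lambda>f \<pi>. \<Sum>k. C (k + n) f \<pi>)"
      using suminf_minus_initial_segment[OF summable_current_values[OF Cc sm]]
      by (simp add: fun_eq_iff D_def Ssum)
    then have "?N (D - S n) B \<le> (\<Sum>k. ?N (C (k + n)) B)"
      using least_bound_suminf_le[of "\<lambda>k. C (k + n)", OF Cc summable_ignore_initial_segment[OF sm]]
      by simp
    then show ?thesis
      using suminf_minus_initial_segment[OF sm[OF B]] by simp
  qed
  \<comment> \<open>Write \<open>T - D\<close> as \<open>(T - S n) - (D - S n)\<close>: the mass of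
    the first part is known exactly, that of the second is bounded by a tail that vanishes as
    \<open>n\<close> grows.\<close>
  have rest: "?N (T - D) B \<le> ?N T B - (\<Sum>k. ?N (C k) B)" if B: "B \<in> bounded_borel" for B
  proof (rule LIMSEQ_le_const)
    have "(\<lambda>n. \<Sum>k<n. ?N (C k) B) \<longlonglongrightarrow> (\<Sum>k. ?N (C k) B)"
      by (rule summable_LIMSEQ[OF sm[OF B]])
    then have "(\<lambda>n. ?N T B - (\<Sum>k<n. ?N (C k) B) + ((\<Sum>k. ?N (C k) B) - (\<Sum>k<n. ?N (C k) B)))
        \<longlonglongrightarrow> ?N T B - (\<Sum>k. ?N (C k) B) + ((\<Sum>k. ?N (C k) B) - (\<Sum>k. ?N (C k) B))"
      by (intro tendsto_intros)
    then show "(\<lambda>n. ?N T B - (\<Sum>k<n. ?N (C k) B) + ((\<Sum>k. ?N (C k) B) - (\<Sum>k<n. ?N (C k) B)))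
        \<longlonglongrightarrow> ?N T B - (\<Sum>k. ?N (C k) B)" by simp
    have "?N (T - D) B \<le> ?N T B - (\<Sum>k<n. ?N (C k) B) + ((\<Sum>k. ?N (C k) B) - (\<Sum>k<n. ?N (C k) B))" for n
    proof -
      have "?N (T - D) B \<le> ?N (T - S n) B + ?N (D - S n) B"
        using least_bound_diff_le[OF currents_diff[OF T Sc] currents_diff[OF Dc Sc], of n n B] by simp
      then show ?thesis using tail[OF B, of n] split[OF B, of n] by simp
    qed
    then show "\<exists>N. \<forall>n\<ge>N. ?N (T - D) B \<le>
        ?N T B - (\<Sum>k<n. ?N (C k) B) + ((\<Sum>k. ?N (C k) B) - (\<Sum>k<n. ?N (C k) B))" by blast
  qed
  have "cycle_of m D T"
  proof -
    have "subcurrent m D T"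
    proof (rule subcurrentI[OF Dc T])
      fix B :: "'a set" assume "B \<in> bounded_borel"
      \<comment> \<open>At index \<open>0\<close> the tail estimate bounds the mass of
        \<open>D\<close> itself, because \<open>S 0 = 0\<close>.\<close>
      then show "?N D B + ?N (T - D) B \<le> ?N T B"
        using tail[of B 0] rest[of B] by (simp add: S0)
    qed
    moreover have "boundary D = 0"
    proof -
      have "boundary (C k) = 0" for k using pick(1)[OF Sc] by (simp add: cycle_of_def)
      \<comment> \<open>The cut-off in \<open>boundary\<close> is selected from \<open>f\<close>
        alone, so it is the same for all \<open>C k\<close> and for \<open>D\<close>, and the
        boundary is taken termwise.\<close>
      moreover have "boundary D f \<pi> = (\<Sum>k. boundary (C k) f \<pi>)" for f \<pi>
        by (simp add: boundary_def D_def)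
      ultimately show ?thesis by (simp add: fun_eq_iff)
    qed
    ultimately show ?thesis by (simp add: cycle_of_def)
  qed
  moreover have "acyclic_current m (T - D)"
    unfolding acyclic_current_def
  proof (intro conjI allI iffI)
    show TD: "T - D \<in> currents m" by (rule currents_diff[OF T Dc])
    show "cycle_of m C' (T - D)" if "C' = 0" for C'
      using zero_cycle_of[OF TD] that by simp
    fix C' assume C': "cycle_of m C' (T - D)"
    then have C'c: "C' \<in> currents m" and C'b: "boundary C' = 0"
      and C's: "\<And>B. B \<in> bounded_borel \<Longrightarrow> ?N (T - D) B = ?N C' B + ?N (T - D - C') B"
      by (auto simp: cycle_of_def subcurrent_iff)
    have "cycle_of m C' (T - S n)" for n
    proof -
      have "subcurrent m C' (T - S n)"
      proof (rule subcurrentI[OF C'c currents_diff[OF T Sc]])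
        fix B :: "'a set" assume B: "B \<in> bounded_borel"
        \<comment> \<open>Adding the mass of \<open>C'\<close> turns the first part into the mass of
          \<open>T - D\<close>; the bounds \<open>rest\<close> and \<open>tail\<close> then sum to
          precisely the mass of \<open>T - S n\<close>.\<close>
        have "T - S n - C' = (T - D - C') + (D - S n)" by simp
        then have "?N (T - S n - C') B \<le> ?N (T - D - C') B + ?N (D - S n) B"
          using least_bound_add_le[OF currents_diff[OF TD C'c] currents_diff[OF Dc Sc]] by metis
        then show "?N C' B + ?N (T - S n - C') B \<le> ?N (T - S n) B"
          using C's[OF B] rest[OF B] tail[OF B, of n] split[OF B, of n] by linarith
      qed
      then show ?thesis using C'b by (simp add: cycle_of_def)
    qed
    then have le: "?N C' (U k) \<le> 2 * ?N (C k) (U k)" for k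
      by (rule pick(2)[OF Sc])
    show "C' = 0"
    proof (rule current_eq_zeroI[OF C'c])
      fix j :: nat
      let ?B = "ball (undefined :: 'a) (real j)"
      have "(\<lambda>k. ?N (C k) ?B) \<longlonglongrightarrow> 0"
        by (rule summable_LIMSEQ_zero[OF sm[OF bounded_borel_ball]])
      \<comment> \<open>Along the indices of radius \<open>j\<close> the pairing is at least
        \<open>i\<close>, so this is a subsequence tending to infinity and inherits the limit
        \<open>0\<close>.\<close>
      moreover have "filterlim (\<lambda>i. prod_encode (j, i)) sequentially sequentially"
        by (rule filterlim_at_top_mono[OF filterlim_ident]) (auto simp: le_prod_encode_2)
      ultimately have "(\<lambda>i. ?N (C (prod_encode (j, i))) ?B) \<longlonglongrightarrow> 0"
        by (rule filterlim_compose)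
      then have "(\<lambda>i. 2 * ?N (C (prod_encode (j, i))) ?B) \<longlonglongrightarrow> 2 * 0"
        by (rule tendsto_mult_left)
      moreover have "?N C' ?B \<le> 2 * ?N (C (prod_encode (j, i))) ?B" for i
        using le[of "prod_encode (j, i)"] by (simp add: U_def)
      ultimately have "?N C' ?B \<le> 2 * 0"
        using LIMSEQ_le_const by blast
      then show "?N C' ?B = 0" using nonneg[OF C'c, of ?B] by simp
    qed
  qed
  ultimately have "cycle_of m D T \<and> acyclic_current m (T - D)" ..
  moreover have "T = (T - D) + D" by simp
  ultimately show ?thesis by blast
qed

end
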